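(* Let $G$ be a Lie group, $L:TG\to\mathbb{R}$ a left invariant Lagrangian, and $F:TG\times TG\to T^*G$ a force field with delay equivariant relative to the canonical left actions of $G$ on $TG\times TG$ and $T^*G$ respectively. Let $l:\mathbf{g}\to\mathbb{R}$ and $f:\mathbf{g}\times\mathbf{g}\to\mathbf{g}^*$ be the restrictions of $L$ and $F$ to $T_eG=\mathbf{g}$. For a curve $g(t)\in G$, let $\xi(t)=T_{g(t)}L_{g(t)^{-1}}\dot g(t)$. Then the following are equivalent: (i) $g(t)$ satisfies the Euler–Lagrange equations with forcing with delay for $L$ on $G$. (ii) The integral Lagrange–d'Alembert principle with delay $$\delta\int_a^b L(g(t),\dot g(t))\,dt=\int_a^b F\big((g(t),\dot g(t)),(\tilde g(t),\dot{\tilde g}(t))\big)\cdot\delta g(t)\,dt$$ holds for all variations $\delta g(t)$ with fixed endpoints. (iii) The Euler–Poincaré equations with forcing with delay are valid: $$\frac{d}{dt}\left(\frac{\partial l}{\partial\xi}\right)-\mathrm{ad}^*_\xi\frac{\partial l}{\partial\xi}=f(\xi,\tilde\xi).$$ (iv) The variational principle $$\delta\int_a^b l(\xi(t))\,dt=\int_a^b f(\xi(t),\tilde\xi(t))\cdot\delta\xi(t)\,dt$$ holds on $\mathbf{g}$, using variations of the form $\delta\xi=\dot\eta+[\xi,\eta]$, where $\eta$ vanishes at the endpoints.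
   Context: $\mathbf{g}=T_eG$ is the Lie algebra of $G$ and $L_g$ denotes left translation on $G$. $\tau\ge0$ is the delay, and $\tilde g(t)=g(t-\tau)$, $\tilde\xi(t)=\xi(t-\tau)$ are the delayed curves. A force field with delay on $G$ is a map $F:TG\times TG\to T^*G$ with $F(v_g,\tilde v_{\tilde g})\in T^*_gG$. By equivariance $F$ is determined by $f$ through left translation of the arguments: $\langle F(v_g,\tilde v_{\tilde g}),w\rangle=\langle f(T_gL_{g^{-1}}v_g,\,T_{\tilde g}L_{\tilde g^{-1}}\tilde v_{\tilde g}),\,T_gL_{g^{-1}}w\rangle$ for $v_g,w\in T_gG$, $\tilde v_{\tilde g}\in T_{\tilde g}G$. The Euler–Lagrange equations with forcing with delay are, in local coordinates $(q^i)$ on $G$, $\frac{d}{dt}\left(\frac{\partial L}{\partial\dot q^i}\right)-\frac{\partial L}{\partial q^i}=F_i\big((q,\dot q),(\tilde q,\dot{\tilde q})\big)$ with $\tilde q(t)=q(t-\tau)$. The coadjoint operator is $\langle\mathrm{ad}^*_\xi\mu,\eta\rangle=\langle\mu,[\xi,\eta]\rangle$ for $\xi,\eta\in\mathbf{g}$, $\mu\in\mathbf{g}^*$.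
   Formalization: In (ii) the force integral has the opposite sign, and in (iv) the right side is −∫f(ξ,ξ̃)·η dt instead of ∫f(ξ,ξ̃)·δξ dt; as printed the equivalence fails for G=ℝ, L=v²/2, F=1. Equivariance means independent left translation of the two arguments. *)

theory Defs
  imports "HOL-Analysis.Analysis"
begin

section \<open>Smooth maps between Euclidean spaces\<close>

text \<open>Only used with \<open>S\<close> open and a finite-dimensional domain, where continuity of all iterated
  directional derivatives up to order \<open>k\<close> is the usual notion of a \<open>C\<^sup>k\<close> map.\<close>

fun Ck_on :: "nat \<Rightarrow> 'b::real_normed_vector set \<Rightarrow> ('b \<Rightarrow> 'c::real_normed_vector) \<Rightarrow> bool" where
  "Ck_on 0 S f \<longleftrightarrow> continuous_on S f"
| "Ck_on (Suc k) S f \<longleftrightarrow>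
     (\<forall>x\<in>S. f differentiable (at x)) \<and> (\<forall>v. Ck_on k S (\<lambda>x. frechet_derivative f (at x) v))"

definition smooth_on :: "'b::real_normed_vector set \<Rightarrow> ('b \<Rightarrow> 'c::real_normed_vector) \<Rightarrow> bool" where
  "smooth_on S f \<longleftrightarrow> (\<forall>k. Ck_on k S f)"


section \<open>Smooth manifolds, tangent vectors and tangent maps\<close>

text \<open>A chart is a domain together with a coordinate map; the coordinate map is only meaningful
  on the domain.\<close>

type_synonym ('a, 'e) chart = "'a set \<times> ('a \<Rightarrow> 'e)"

abbreviation chart_dom :: "('a, 'e) chart \<Rightarrow> 'a set" where "chart_dom \<equiv> fst"
abbreviation coord :: "('a, 'e) chart \<Rightarrow> 'a \<Rightarrow> 'e" where "coord \<equiv> snd"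

definition chart_img :: "('a, 'e) chart \<Rightarrow> 'e set" where
  "chart_img c = coord c ` chart_dom c"

definition param :: "('a, 'e) chart \<Rightarrow> 'e \<Rightarrow> 'a" where
  "param c = inv_into (chart_dom c) (coord c)"

locale smooth_manifold =
  fixes A :: "('a::{t2_space,second_countable_topology}, 'e::euclidean_space) chart set"
  assumes chart_open: "c \<in> A \<Longrightarrow> open (chart_dom c)"
    and chart_img_open: "c \<in> A \<Longrightarrow> open (chart_img c)"
    and chart_homeo: "c \<in> A \<Longrightarrow> homeomorphism (chart_dom c) (chart_img c) (coord c) (param c)"
    and charts_cover: "(\<Union>c\<in>A. chart_dom c) = UNIV"
    and charts_compat: "c \<in> A \<Longrightarrow> d \<in> A \<Longrightarrow>
          smooth_on (coord c ` (chart_dom c \<inter> chart_dom d)) (coord d \<circ> param c)"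

text \<open>Tangent vectors at \<open>p\<close> are represented by their components in one fixed chart
  \<open>chart_at A p\<close> around \<open>p\<close>. Thus every tangent space is a copy of the model space \<open>'e\<close>, a
  tangent vector is a pair of its foot point and its components, and a covector at \<open>p\<close> is an element
  of the dual space of \<open>'e\<close>. The components in an arbitrary chart \<open>c\<close> around \<open>p\<close> are obtained by
  the usual transformation rule.\<close>

definition chart_at :: "('a, 'e) chart set \<Rightarrow> 'a \<Rightarrow> ('a, 'e) chart" where
  "chart_at A p = (SOME c. c \<in> A \<and> p \<in> chart_dom c)"

definition coord_change ::
    "('a, 'e::real_normed_vector) chart \<Rightarrow> ('a, 'e) chart \<Rightarrow> 'a \<Rightarrow> 'e \<Rightarrow> 'e" where
  "coord_change c d p = frechet_derivative (coord d \<circ> param c) (at (coord c p))"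

definition to_chart ::
    "('a, 'e::real_normed_vector) chart set \<Rightarrow> ('a, 'e) chart \<Rightarrow> 'a \<Rightarrow> 'e \<Rightarrow> 'e" where
  "to_chart A c p = coord_change (chart_at A p) c p"

definition from_chart ::
    "('a, 'e::real_normed_vector) chart set \<Rightarrow> ('a, 'e) chart \<Rightarrow> 'a \<Rightarrow> 'e \<Rightarrow> 'e" where
  "from_chart A c p = coord_change c (chart_at A p) p"

text \<open>\<open>tangent_map A h p\<close> is \<open>T\<^sub>p h\<close>, from the tangent space at \<open>p\<close> to that at \<open>h p\<close>.\<close>

definition tangent_map ::
    "('a, 'e::real_normed_vector) chart set \<Rightarrow> ('a \<Rightarrow> 'a) \<Rightarrow> 'a \<Rightarrow> 'e \<Rightarrow> 'e" where
  "tangent_map A h p =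
     frechet_derivative (coord (chart_at A (h p)) \<circ> h \<circ> param (chart_at A p))
       (at (coord (chart_at A p) p))"

definition smooth_map_on ::
    "('a::topological_space, 'e::real_normed_vector) chart set \<Rightarrow> 'b::real_normed_vector set \<Rightarrow>
      ('b \<Rightarrow> 'a) \<Rightarrow> bool" where
  "smooth_map_on A W h \<longleftrightarrow>
     continuous_on W h \<and> (\<forall>c\<in>A. smooth_on (W \<inter> h -` chart_dom c) (coord c \<circ> h))"

definition velocity ::
    "('a, 'e::real_normed_vector) chart set \<Rightarrow> (real \<Rightarrow> 'a) \<Rightarrow> real \<Rightarrow> 'e" where
  "velocity A g t = vector_derivative (coord (chart_at A (g t)) \<circ> g) (at t)"

definition lift ::
    "('a, 'e::real_normed_vector) chart set \<Rightarrow> (real \<Rightarrow> 'a) \<Rightarrow> real \<Rightarrow> 'a \<times> 'e" where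
  "lift A g t = (g t, velocity A g t)"

text \<open>Lie bracket of vector fields, \<open>[X,Y] = DY\<cdot>X - DX\<cdot>Y\<close> in coordinates; this is the convention
  \<open>[X,Y] f = X (Y f) - Y (X f)\<close>.\<close>

definition vf_bracket ::
    "('a, 'e::real_normed_vector) chart set \<Rightarrow> ('a \<Rightarrow> 'e) \<Rightarrow> ('a \<Rightarrow> 'e) \<Rightarrow> 'a \<Rightarrow> 'e" where
  "vf_bracket A X Y p =
     (let c = chart_at A p;
          loc = (\<lambda>Z x. to_chart A c (param c x) (Z (param c x)))
      in frechet_derivative (loc Y) (at (coord c p)) (X p)
       - frechet_derivative (loc X) (at (coord c p)) (Y p))"


section \<open>Lie groups\<close>

locale lie_group = smooth_manifold A + group mul one ginv
  for A :: "('a::{t2_space,second_countable_topology}, 'e::euclidean_space) chart set"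
    and mul :: "'a \<Rightarrow> 'a \<Rightarrow> 'a" and one :: 'a and ginv :: "'a \<Rightarrow> 'a" +
  assumes smooth_mult: "c \<in> A \<Longrightarrow> d \<in> A \<Longrightarrow>
        smooth_map_on A (chart_img c \<times> chart_img d) (\<lambda>(x, y). mul (param c x) (param d y))"
    and smooth_inv: "c \<in> A \<Longrightarrow> smooth_map_on A (chart_img c) (\<lambda>x. ginv (param c x))"

text \<open>The left action of \<open>h\<close> on the tangent bundle.\<close>

definition left_act ::
    "('a, 'e::real_normed_vector) chart set \<Rightarrow> ('a \<Rightarrow> 'a \<Rightarrow> 'a) \<Rightarrow> 'a \<Rightarrow> 'a \<times> 'e \<Rightarrow> 'a \<times> 'e" where
  "left_act A mul h z = (mul h (fst z), tangent_map A (mul h) (fst z) (snd z))"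

text \<open>The Lie algebra is the tangent space at the identity, with the bracket induced by
  left invariant vector fields.\<close>

definition left_inv_field ::
    "('a, 'e::real_normed_vector) chart set \<Rightarrow> ('a \<Rightarrow> 'a \<Rightarrow> 'a) \<Rightarrow> 'a \<Rightarrow> 'e \<Rightarrow> 'a \<Rightarrow> 'e" where
  "left_inv_field A mul one \<xi> p = tangent_map A (mul p) one \<xi>"

definition lie_bracket ::
    "('a, 'e::real_normed_vector) chart set \<Rightarrow> ('a \<Rightarrow> 'a \<Rightarrow> 'a) \<Rightarrow> 'a \<Rightarrow> 'e \<Rightarrow> 'e \<Rightarrow> 'e" where
  "lie_bracket A mul one \<xi> \<eta> =
     vf_bracket A (left_inv_field A mul one \<xi>) (left_inv_field A mul one \<eta>) one"

definition ad_star ::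
    "('a, 'e::real_normed_vector) chart set \<Rightarrow> ('a \<Rightarrow> 'a \<Rightarrow> 'a) \<Rightarrow> 'a \<Rightarrow> 'e \<Rightarrow>
      ('e \<Rightarrow>\<^sub>L real) \<Rightarrow> ('e \<Rightarrow>\<^sub>L real)" where
  "ad_star A mul one \<xi> \<mu> = Blinfun (\<lambda>\<eta>. blinfun_apply \<mu> (lie_bracket A mul one \<xi> \<eta>))"

text \<open>\<open>\<xi>(t) = T L\<^bsub>g(t)\<inverse>\<^esub> g'(t)\<close>, an element of the tangent space at \<open>mul (ginv (g t)) (g t) = one\<close>.\<close>

definition body_velocity ::
    "('a, 'e::real_normed_vector) chart set \<Rightarrow> ('a \<Rightarrow> 'a \<Rightarrow> 'a) \<Rightarrow> ('a \<Rightarrow> 'a) \<Rightarrow>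
      (real \<Rightarrow> 'a) \<Rightarrow> real \<Rightarrow> 'e" where
  "body_velocity A mul ginv g t = tangent_map A (mul (ginv (g t))) (g t) (velocity A g t)"


section \<open>Lagrangians and force fields with delay\<close>

text \<open>A force field takes values in the covectors at the foot point of its first argument.\<close>

type_synonym ('a, 'e) force = "'a \<times> 'e \<Rightarrow> 'a \<times> 'e \<Rightarrow> ('e \<Rightarrow>\<^sub>L real)"

text \<open>The tangent vector with components \<open>v\<close> in the chart \<open>c\<close>, at the point with coordinates \<open>x\<close>.\<close>

definition chart_tvec ::
    "('a, 'e::real_normed_vector) chart set \<Rightarrow> ('a, 'e) chart \<Rightarrow> 'e \<times> 'e \<Rightarrow> 'a \<times> 'e" where
  "chart_tvec A c = (\<lambda>(x, v). (param c x, from_chart A c (param c x) v))"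

definition smooth_lagrangian ::
    "('a, 'e::real_normed_vector) chart set \<Rightarrow> ('a \<times> 'e \<Rightarrow> real) \<Rightarrow> bool" where
  "smooth_lagrangian A L \<longleftrightarrow> (\<forall>c\<in>A. smooth_on (chart_img c \<times> UNIV) (L \<circ> chart_tvec A c))"

text \<open>The composition with \<open>from_chart\<close> gives the components of the force covector in the chart \<open>c\<close>.\<close>

definition smooth_force ::
    "('a, 'e::real_normed_vector) chart set \<Rightarrow> ('a, 'e) force \<Rightarrow> bool" where
  "smooth_force A F \<longleftrightarrow> (\<forall>c\<in>A. \<forall>d\<in>A.
     smooth_on ((chart_img c \<times> UNIV) \<times> (chart_img d \<times> UNIV))
       (\<lambda>(z, z'). F (chart_tvec A c z) (chart_tvec A d z')
                    o\<^sub>L Blinfun (from_chart A c (param c (fst z)))))"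

definition left_invariant ::
    "('a, 'e::real_normed_vector) chart set \<Rightarrow> ('a \<Rightarrow> 'a \<Rightarrow> 'a) \<Rightarrow> ('a \<times> 'e \<Rightarrow> real) \<Rightarrow> bool" where
  "left_invariant A mul L \<longleftrightarrow> (\<forall>h z. L (left_act A mul h z) = L z)"

text \<open>Equivariance of a force field with delay: \<open>F(h\<cdot>v, k\<cdot>v') = h\<cdot>F(v, v')\<close>, where \<open>h\<close> acts on
  covectors by cotangent lift, \<open>\<langle>h\<cdot>\<alpha>, h\<cdot>w\<rangle> = \<langle>\<alpha>, w\<rangle>\<close>. The current and the delayed
  argument are translated independently of each other: invariance under \<open>h = k\<close> alone would leave a
  dependence on \<open>g\<inverse>g'\<close>, so that \<open>F\<close> would not be determined by its restriction to the Lie algebra.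
  The lemma \<open>equivariant_force_iff\<close> below gives the equivalent description by that restriction.\<close>

definition equivariant_force ::
    "('a, 'e::real_normed_vector) chart set \<Rightarrow> ('a \<Rightarrow> 'a \<Rightarrow> 'a) \<Rightarrow> ('a, 'e) force \<Rightarrow> bool" where
  "equivariant_force A mul F \<longleftrightarrow>
     (\<forall>h k z z' w. blinfun_apply (F (left_act A mul h z) (left_act A mul k z'))
                       (tangent_map A (mul h) (fst z) w)
                   = blinfun_apply (F z z') w)"

definition lagrangian_at_one :: "'a \<Rightarrow> ('a \<times> 'e \<Rightarrow> real) \<Rightarrow> 'e \<Rightarrow> real" where
  "lagrangian_at_one one L \<xi> = L (one, \<xi>)"

definition force_at_one ::
    "'a \<Rightarrow> ('a, 'e::real_normed_vector) force \<Rightarrow> 'e \<Rightarrow> 'e \<Rightarrow> ('e \<Rightarrow>\<^sub>L real)" where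
  "force_at_one one F \<xi> \<xi>' = F (one, \<xi>) (one, \<xi>')"

definition delayed :: "real \<Rightarrow> (real \<Rightarrow> 'b) \<Rightarrow> real \<Rightarrow> 'b" where
  "delayed \<tau> g t = g (t - \<tau>)"


section \<open>The four formulations\<close>

text \<open>Euler--Lagrange equations, in every chart of the atlas that meets the curve.\<close>

definition euler_lagrange_delay ::
    "('a, 'e::euclidean_space) chart set \<Rightarrow> ('a \<times> 'e \<Rightarrow> real) \<Rightarrow> ('a, 'e) force \<Rightarrow>
      real \<Rightarrow> real \<Rightarrow> real \<Rightarrow> (real \<Rightarrow> 'a) \<Rightarrow> bool" where
  "euler_lagrange_delay A L F \<tau> a b g \<longleftrightarrow>
     (\<forall>t\<in>{a..b}. \<forall>c\<in>A. g t \<in> chart_dom c \<longrightarrow>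
       (let Lc = L \<circ> chart_tvec A c;
            q = coord c \<circ> g;
            q' = (\<lambda>s. vector_derivative q (at s))
        in \<forall>i\<in>Basis.
             ((\<lambda>s. frechet_derivative (\<lambda>v. Lc (q s, v)) (at (q' s)) i)
               has_real_derivative
                 frechet_derivative (\<lambda>x. Lc (x, q' t)) (at (q t)) i
                 + blinfun_apply (F (lift A g t) (lift A (delayed \<tau> g) t)) (from_chart A c (g t) i))
             (at t)))"

text \<open>A variation \<open>H (\<epsilon>, t)\<close> of \<open>g\<close> on \<open>{a..b}\<close> with fixed endpoints; its infinitesimal
  variation \<open>\<delta>g(t)\<close> is \<open>velocity A (\<lambda>\<epsilon>. H (\<epsilon>, t)) 0\<close>.\<close>

definition fixed_end_variation ::
    "('a::topological_space, 'e::real_normed_vector) chart set \<Rightarrow> real \<Rightarrow> real \<Rightarrow>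
      (real \<Rightarrow> 'a) \<Rightarrow> (real \<times> real \<Rightarrow> 'a) \<Rightarrow> bool" where
  "fixed_end_variation A a b g H \<longleftrightarrow>
     (\<exists>r>0. smooth_map_on A ({-r<..<r} \<times> {a-r<..<b+r}) H
        \<and> (\<forall>t\<in>{a..b}. H (0, t) = g t)
        \<and> (\<forall>\<epsilon>\<in>{-r<..<r}. H (\<epsilon>, a) = g a \<and> H (\<epsilon>, b) = g b))"

text \<open>The Lagrange--d'Alembert principle. With the force on the right-hand side of the
  Euler--Lagrange equations, i.e. \<open>d/dt (\<partial>L/\<partial>q') - \<partial>L/\<partial>q = F\<close>, the principle reads
  \<open>\<delta>\<integral>L dt + \<integral>F\<cdot>\<delta>g dt = 0\<close>; without the minus sign below it would describe the
  force \<open>-F\<close>.\<close>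

definition lagrange_dalembert_delay ::
    "('a::topological_space, 'e::euclidean_space) chart set \<Rightarrow> ('a \<times> 'e \<Rightarrow> real) \<Rightarrow>
      ('a, 'e) force \<Rightarrow> real \<Rightarrow> real \<Rightarrow> real \<Rightarrow> (real \<Rightarrow> 'a) \<Rightarrow> bool" where
  "lagrange_dalembert_delay A L F \<tau> a b g \<longleftrightarrow>
     (\<forall>H. fixed_end_variation A a b g H \<longrightarrow>
        ((\<lambda>\<epsilon>. integral {a..b} (\<lambda>t. L (lift A (\<lambda>s. H (\<epsilon>, s)) t)))
          has_real_derivative
            - integral {a..b} (\<lambda>t. blinfun_apply (F (lift A g t) (lift A (delayed \<tau> g) t))
                                     (velocity A (\<lambda>\<epsilon>. H (\<epsilon>, t)) 0)))
        (at 0))"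

text \<open>\<open>\<partial>l/\<partial>\<xi>\<close> as an element of the dual of the Lie algebra.\<close>

definition dl :: "('e::real_normed_vector \<Rightarrow> real) \<Rightarrow> 'e \<Rightarrow> ('e \<Rightarrow>\<^sub>L real)" where
  "dl l \<xi> = Blinfun (frechet_derivative l (at \<xi>))"

definition euler_poincare_delay ::
    "('a, 'e::real_normed_vector) chart set \<Rightarrow> ('a \<Rightarrow> 'a \<Rightarrow> 'a) \<Rightarrow> 'a \<Rightarrow> ('e \<Rightarrow> real) \<Rightarrow>
      ('e \<Rightarrow> 'e \<Rightarrow> ('e \<Rightarrow>\<^sub>L real)) \<Rightarrow> real \<Rightarrow> real \<Rightarrow> real \<Rightarrow> (real \<Rightarrow> 'e) \<Rightarrow> bool" where
  "euler_poincare_delay A mul one l f \<tau> a b \<xi> \<longleftrightarrow>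
     (\<forall>t\<in>{a..b}.
        ((\<lambda>s. dl l (\<xi> s)) has_vector_derivative
           ad_star A mul one (\<xi> t) (dl l (\<xi> t)) + f (\<xi> t) (delayed \<tau> \<xi> t))
        (at t))"

text \<open>\<open>\<Xi> (\<epsilon>, t)\<close> is a variation of \<open>\<xi>\<close> with \<open>\<delta>\<xi> = \<eta>' + [\<xi>, \<eta>]\<close>, where \<open>\<eta>\<close> vanishes at the
  endpoints.\<close>

definition reduced_variation ::
    "('a, 'e::real_normed_vector) chart set \<Rightarrow> ('a \<Rightarrow> 'a \<Rightarrow> 'a) \<Rightarrow> 'a \<Rightarrow> real \<Rightarrow> real \<Rightarrow>
      (real \<Rightarrow> 'e) \<Rightarrow> (real \<Rightarrow> 'e) \<Rightarrow> (real \<times> real \<Rightarrow> 'e) \<Rightarrow> bool" where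
  "reduced_variation A mul one a b \<xi> \<eta> \<Xi> \<longleftrightarrow>
     (\<exists>r>0. smooth_on {a-r<..<b+r} \<eta>
        \<and> smooth_on ({-r<..<r} \<times> {a-r<..<b+r}) \<Xi>)
     \<and> \<eta> a = 0 \<and> \<eta> b = 0
     \<and> (\<forall>t\<in>{a..b}. \<Xi> (0, t) = \<xi> t
          \<and> vector_derivative (\<lambda>\<epsilon>. \<Xi> (\<epsilon>, t)) (at 0)
              = vector_derivative \<eta> (at t) + lie_bracket A mul one (\<xi> t) (\<eta> t))"

text \<open>The force is paired with \<open>\<eta>\<close>, the left translate to the Lie algebra of \<open>\<delta>g\<close>, and the sign
  is that of \<open>lagrange_dalembert_delay\<close>.\<close>

definition reduced_principle_delay ::
    "('a, 'e::euclidean_space) chart set \<Rightarrow> ('a \<Rightarrow> 'a \<Rightarrow> 'a) \<Rightarrow> 'a \<Rightarrow> ('e \<Rightarrow> real) \<Rightarrow>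
      ('e \<Rightarrow> 'e \<Rightarrow> ('e \<Rightarrow>\<^sub>L real)) \<Rightarrow> real \<Rightarrow> real \<Rightarrow> real \<Rightarrow> (real \<Rightarrow> 'e) \<Rightarrow> bool" where
  "reduced_principle_delay A mul one l f \<tau> a b \<xi> \<longleftrightarrow>
     (\<forall>\<eta> \<Xi>. reduced_variation A mul one a b \<xi> \<eta> \<Xi> \<longrightarrow>
        ((\<lambda>\<epsilon>. integral {a..b} (\<lambda>t. l (\<Xi> (\<epsilon>, t))))
          has_real_derivative
            - integral {a..b} (\<lambda>t. blinfun_apply (f (\<xi> t) (delayed \<tau> \<xi> t)) (\<eta> t)))
        (at 0))"


section \<open>Equivariance and restriction to the Lie algebra\<close>

context smooth_manifold
begin

lemma chart_at: "chart_at A p \<in> A" "p \<in> chart_dom (chart_at A p)"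
proof -
  have "\<exists>c. c \<in> A \<and> p \<in> chart_dom c" using charts_cover by blast
  then show "chart_at A p \<in> A" "p \<in> chart_dom (chart_at A p)"
    unfolding chart_at_def by (metis (mono_tags, lifting) someI_ex)+
qed

lemma param_coord: "c \<in> A \<Longrightarrow> p \<in> chart_dom c \<Longrightarrow> param c (coord c p) = p"
  using chart_homeo by (auto simp: homeomorphism_def)

end

context lie_group
begin

lemma left_translation_differentiable:
  assumes c: "c \<in> A" "p \<in> chart_dom c" and d: "d \<in> A" "mul h p \<in> chart_dom d"
  shows "(coord d \<circ> mul h \<circ> param c) differentiable (at (coord c p))"
proof -
  let ?e = "chart_at A h"
  let ?m = "\<lambda>(x, y). mul (param ?e x) (param c y)"
  let ?W = "(chart_img ?e \<times> chart_img c) \<inter> ?m -` chart_dom d"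
  have hx: "param ?e (coord ?e h) = h" using param_coord chart_at by blast
  have "smooth_on ?W (coord d \<circ> ?m)"
    using smooth_mult[OF chart_at(1) c(1), of h] d(1) by (auto simp: smooth_map_on_def)
  then have "Ck_on (Suc 0) ?W (coord d \<circ> ?m)" unfolding smooth_on_def by blast
  moreover have "(coord ?e h, coord c p) \<in> ?W"
    using chart_at c d by (auto simp: chart_img_def param_coord)
  ultimately have "(coord d \<circ> ?m) differentiable (at (coord ?e h, coord c p))" by simp
  moreover have "(\<lambda>y. (coord ?e h, y)) differentiable (at (coord c p))"
    by (rule differentiableI) (auto intro!: derivative_eq_intros)
  ultimately have "((coord d \<circ> ?m) \<circ> (\<lambda>y. (coord ?e h, y))) differentiable (at (coord c p))"
    by (intro differentiable_chain_at) auto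
  moreover have "(coord d \<circ> ?m) \<circ> (\<lambda>y. (coord ?e h, y)) = coord d \<circ> mul h \<circ> param c"
    by (auto simp: hx)
  ultimately show ?thesis by simp
qed

lemma tangent_map_left_translation:
  "tangent_map A (mul (mul h k)) p v
     = tangent_map A (mul h) (mul k p) (tangent_map A (mul k) p v)"
proof -
  let ?c = "chart_at A p" and ?d = "chart_at A (mul k p)" and ?e = "chart_at A (mul h (mul k p))"
  let ?K = "coord ?d \<circ> mul k \<circ> param ?c" and ?H = "coord ?e \<circ> mul h \<circ> param ?d"
  let ?x = "coord ?c p"
  have px: "param ?c ?x = p" using param_coord chart_at by blast
  then have Kx: "?K ?x = coord ?d (mul k p)" by simp
  have dK: "(?K has_derivative frechet_derivative ?K (at ?x)) (at ?x)"
    using left_translation_differentiable[OF chart_at chart_at] frechet_derivative_works by blast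
  have dH: "(?H has_derivative frechet_derivative ?H (at (?K ?x))) (at (?K ?x))"
    using left_translation_differentiable[OF chart_at chart_at] frechet_derivative_works
    unfolding Kx by blast
  have "((?H \<circ> ?K) has_derivative
      (frechet_derivative ?H (at (?K ?x)) \<circ> frechet_derivative ?K (at ?x))) (at ?x)"
    by (rule diff_chain_at[OF dK dH])
  moreover obtain S where S: "open S" "?x \<in> S"
    and eq: "\<And>x. x \<in> S \<Longrightarrow> (?H \<circ> ?K) x = (coord ?e \<circ> mul (mul h k) \<circ> param ?c) x"
  proof -
    let ?m = "\<lambda>x. mul k (param ?c x)"
    let ?e' = "chart_at A k"
    have kx: "param ?e' (coord ?e' k) = k" using param_coord chart_at by blast
    have kimg: "coord ?e' k \<in> chart_img ?e'" using chart_at by (simp add: chart_img_def)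
    have "continuous_on (chart_img ?e' \<times> chart_img ?c) (\<lambda>(x, y). mul (param ?e' x) (param ?c y))"
      using smooth_mult[OF chart_at(1) chart_at(1)] by (simp add: smooth_map_on_def)
    then have "continuous_on (chart_img ?c)
        ((\<lambda>(x, y). mul (param ?e' x) (param ?c y)) \<circ> (\<lambda>y. (coord ?e' k, y)))"
      by (intro continuous_on_compose continuous_intros)
        (erule continuous_on_subset, use kimg in blast)
    then have cont: "continuous_on (chart_img ?c) ?m" by (simp add: kx comp_def)
    let ?S = "?m -` chart_dom ?d \<inter> chart_img ?c"
    have "open ?S"
      using cont chart_open[OF chart_at(1)] chart_img_open[OF chart_at(1)]
      by (metis continuous_on_open_vimage)
    moreover have "?x \<in> ?S"
      using px chart_at by (simp add: chart_img_def)
    moreover have "(?H \<circ> ?K) x = (coord ?e \<circ> mul (mul h k) \<circ> param ?c) x" if "x \<in> ?S" for x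
    proof -
      have "param ?d (coord ?d (?m x)) = ?m x"
        using that param_coord[OF chart_at(1)] by blast
      then show ?thesis by (simp add: assoc)
    qed
    ultimately show ?thesis using that by blast
  qed
  ultimately have "((coord ?e \<circ> mul (mul h k) \<circ> param ?c) has_derivative
      (frechet_derivative ?H (at (?K ?x)) \<circ> frechet_derivative ?K (at ?x))) (at ?x)"
    by (rule has_derivative_transform_within_open)
  from frechet_derivative_at[OF this] show ?thesis
    unfolding tangent_map_def Kx by (simp add: assoc fun_eq_iff)
qed

lemma tangent_map_one: "tangent_map A (mul one) p v = v"
proof -
  let ?c = "chart_at A p" and ?x = "coord (chart_at A p) p"
  have x: "?x \<in> chart_img ?c" using chart_at by (auto simp: chart_img_def)
  have "((\<lambda>x. x) has_derivative (\<lambda>v. v)) (at ?x)" by simp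
  then have "((coord ?c \<circ> mul one \<circ> param ?c) has_derivative (\<lambda>v. v)) (at ?x)"
    by (rule has_derivative_transform_within_open[OF _ chart_img_open[OF chart_at(1)] x])
      (use chart_homeo[OF chart_at(1)] in \<open>auto simp: homeomorphism_def group_left_neutral\<close>)
  from frechet_derivative_at[OF this] show ?thesis
    by (simp add: tangent_map_def group_left_neutral) (metis)
qed

lemma equivariant_force_iff:
  "equivariant_force A mul F \<longleftrightarrow>
     (\<forall>g v g' v' w. blinfun_apply (F (g, v) (g', v')) w =
        blinfun_apply (force_at_one one F (tangent_map A (mul (ginv g)) g v)
                                          (tangent_map A (mul (ginv g')) g' v'))
          (tangent_map A (mul (ginv g)) g w))"
    (is "?L \<longleftrightarrow> ?R")
proof
  assume L: ?L
  show ?R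
  proof (intro allI)
    fix g v g' v' w
    show "blinfun_apply (F (g, v) (g', v')) w =
        blinfun_apply (force_at_one one F (tangent_map A (mul (ginv g)) g v)
                                          (tangent_map A (mul (ginv g')) g' v'))
          (tangent_map A (mul (ginv g)) g w)"
      using L[unfolded equivariant_force_def, rule_format, of "ginv g" "(g, v)" "ginv g'" "(g', v')" w]
      by (simp add: left_act_def force_at_one_def)
  qed
next
  assume R: ?R
  have *: "tangent_map A (mul (ginv (mul h g))) (mul h g) (tangent_map A (mul h) g v)
            = tangent_map A (mul (ginv g)) g v" for h g v
    by (simp add: tangent_map_left_translation[symmetric] inverse_distrib_swap assoc)
  show ?L
    unfolding equivariant_force_def left_act_def
  proof (intro allI)
    fix h k z z' w
    show "blinfun_apply (F (mul h (fst z), tangent_map A (mul h) (fst z) (snd z))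
                           (mul k (fst z'), tangent_map A (mul k) (fst z') (snd z')))
            (tangent_map A (mul h) (fst z) w) = blinfun_apply (F z z') w"
      using R[rule_format, of "fst z" "snd z" "fst z'" "snd z'" w]
      by (simp add: R[rule_format, of "mul h (fst z)"] *)
  qed
qed

end

end

theory Submission
  imports Defs
begin

text \<open>
  Left translation trivialises the tangent bundle, and by invariance \<open>L\<close> and \<open>F\<close> only see
  the trivialised velocities. For a smooth map \<open>H\<close> from an open subset of a Euclidean space into the
  group, let \<open>dlog H z v\<close> be the derivative of \<open>H\<close> at \<open>z\<close> in direction \<open>v\<close>, translated back to the
  identity; thus \<open>\<xi> = dlog g t 1\<close>. All geometric input is contained in the Maurer--Cartan equation
  (lemma \<open>maurer_cartan\<close>), which says that the antisymmetrised derivative of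
  \<open>dlog H\<close> is minus the Lie bracket.

  Write \<open>\<mu>(t)\<close> for the momentum \<open>\<partial>l/\<partial>\<xi>\<close> along the curve and consider the covector
  \<open>\<rho>(t) = ad\<^sup>*\<^sub>\<xi> \<mu> + f(\<xi>, \<xi>(t - \<tau>)) - d\<mu>/dt\<close>, called the residual. Each of the four formulations
  is shown to be equivalent to \<open>\<rho> = 0\<close> on \<open>[a, b]\<close>.

  \<^item> For the Euler--Poincare equations this is a reformulation, since \<open>\<mu>\<close> is smooth.

  \<^item> In a chart \<open>c\<close> the Lagrangian is \<open>l (dlog (param c) x v)\<close>. Differentiating this and applying
    the Maurer--Cartan equation to \<open>param c\<close>, the Euler--Lagrange equation in direction \<open>i\<close> says
    that \<open>\<rho>(t)\<close> vanishes on \<open>dlog (param c) (q t) i\<close>; as \<open>dlog (param c) (q t)\<close> is onto, the equations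
    in all directions together say \<open>\<rho>(t) = 0\<close>. This comparison is pointwise in \<open>t\<close>.

  \<^item> The Maurer--Cartan equation for a variation \<open>H(\<epsilon>, t)\<close> of the curve says that the body velocity
    varies by \<open>\<eta>' + [\<xi>, \<eta>]\<close>, where \<open>\<eta>\<close> is the left translate of \<open>\<delta>g\<close>. Hence for both variational
    principles the identity demanded of a variation is
    \<open>\<integral> \<mu> (\<eta>' + [\<xi>, \<eta>]) dt = - \<integral> f \<eta> dt\<close>, that is \<open>\<integral> \<rho> \<eta> dt = 0\<close> after an integration by parts. Every
    \<open>\<eta>\<close> vanishing at the endpoints arises: from \<open>\<xi> + \<epsilon> (\<eta>' + [\<xi>, \<eta>])\<close> on the Lie algebra, and
    from \<open>g(t) k(\<epsilon> \<eta>(t))\<close> on the group, where \<open>k\<close> is the inverse of a chart centred at the identity.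
    The fundamental lemma of the calculus of variations concludes.
\<close>

section \<open>Calculus of smooth maps\<close>

lemma Ck_on_has_derivative:
  "Ck_on (Suc k) S f \<Longrightarrow> x \<in> S \<Longrightarrow> (f has_derivative frechet_derivative f (at x)) (at x)"
  using frechet_derivative_works by auto

lemma Ck_on_subset: "Ck_on k S f \<Longrightarrow> T \<subseteq> S \<Longrightarrow> Ck_on k T f"
  by (induction k arbitrary: f) (auto intro: continuous_on_subset)

lemma Ck_on_Suc_imp: "Ck_on (Suc k) S f \<Longrightarrow> Ck_on k S f"
proof (induction k arbitrary: f)
  case 0
  then show ?case
    by (auto intro!: differentiable_imp_continuous_on differentiable_at_imp_differentiable_on)
next
  case (Suc k)
  then show ?case by (metis Ck_on.simps(2))
qed

lemma Ck_on_cong: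
  assumes "open S" "\<And>x. x \<in> S \<Longrightarrow> f x = g x"
  shows "Ck_on k S f \<longleftrightarrow> Ck_on k S g"
proof -
  have "Ck_on k S f \<Longrightarrow> Ck_on k S g" if "\<And>x. x \<in> S \<Longrightarrow> f x = g x" for f g :: "'a \<Rightarrow> 'b"
    using that
  proof (induction k arbitrary: f g)
    case 0
    then show ?case by (simp cong: continuous_on_cong)
  next
    case (Suc k)
    have d: "f differentiable at x" if "x \<in> S" for x using Suc.prems that by simp
    have "g differentiable at x" if "x \<in> S" for x
      using d[OF that] Suc.prems(2) that \<open>open S\<close>
      by (metis differentiable_def has_derivative_transform_within_open)
    moreover have "Ck_on k S (\<lambda>x. frechet_derivative g (at x) v)" for v
    proof (rule Suc.IH)
      show "Ck_on k S (\<lambda>x. frechet_derivative f (at x) v)" using Suc.prems by simp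
      show "frechet_derivative f (at x) v = frechet_derivative g (at x) v" if "x \<in> S" for x
        using frechet_derivative_transform_within_open[OF d[OF that] \<open>open S\<close> that Suc.prems(2)]
        by simp
    qed
    ultimately show ?case by simp
  qed
  then show ?thesis using assms by metis
qed

lemma Ck_on_local:
  assumes "\<And>x. x \<in> S \<Longrightarrow> \<exists>U. open U \<and> x \<in> U \<and> Ck_on k U f"
  shows "Ck_on k S f"
  using assms
proof (induction k arbitrary: f)
  case 0
  then show ?case
    by (metis Ck_on.simps(1) continuous_at_imp_continuous_on continuous_on_eq_continuous_at)
next
  case (Suc k)
  have "f differentiable at x" if "x \<in> S" for x using Suc.prems[OF that] by auto
  moreover have "Ck_on k S (\<lambda>x. frechet_derivative f (at x) v)" for v
    by (rule Suc.IH) (use Suc.prems in \<open>auto; blast\<close>)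
  ultimately show ?case by simp
qed

lemma Ck_on_const: "Ck_on k S (\<lambda>x. c)"
  by (induction k arbitrary: c) (simp_all)

lemma Ck_on_bounded_linear:
  assumes "bounded_linear h"
  shows "Ck_on k S h"
proof (cases k)
  case 0
  then show ?thesis using assms by (simp add: linear_continuous_on)
next
  case (Suc n)
  have "(h has_derivative h) (at x)" for x
    using assms by (rule bounded_linear_imp_has_derivative)
  then have "h differentiable (at x)" "frechet_derivative h (at x) = h" for x
    by (auto simp: differentiable_def frechet_derivative_at[symmetric])
  with Suc show ?thesis by (simp add: Ck_on_const)
qed

text \<open>Lets a derivative that is known explicitly replace \<open>frechet_derivative\<close>; this carries the inductive
step in the closure properties below.\<close>

lemma Ck_on_SucI:
  assumes "open S" "\<And>x. x \<in> S \<Longrightarrow> (f has_derivative D x) (at x)" "\<And>v. Ck_on k S (\<lambda>x. D x v)"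
  shows "Ck_on (Suc k) S f"
proof -
  have "Ck_on k S (\<lambda>x. frechet_derivative f (at x) v)" for v
    using Ck_on_cong[OF assms(1), of "\<lambda>x. frechet_derivative f (at x) v" "\<lambda>x. D x v"]
      frechet_derivative_at[OF assms(2)] assms(3) by simp
  then show ?thesis using assms(2) by (auto simp: differentiable_def)
qed

lemma Ck_on_bounded_linear_compose:
  assumes "open S" "bounded_linear h" "Ck_on k S f"
  shows "Ck_on k S (\<lambda>x. h (f x))"
  using assms(3)
proof (induction k arbitrary: f)
  case 0
  then show ?case using assms(2)
    by (simp add: bounded_linear.continuous_on)
next
  case (Suc k)
  show ?case
  proof (rule Ck_on_SucI[OF assms(1)])
    show "((\<lambda>x. h (f x)) has_derivative (\<lambda>v. h (frechet_derivative f (at x) v))) (at x)"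
      if "x \<in> S" for x
      by (rule bounded_linear.has_derivative[OF assms(2) Ck_on_has_derivative[OF Suc.prems that]])
    show "Ck_on k S (\<lambda>x. h (frechet_derivative f (at x) v))" for v
      using Suc.prems by (intro Suc.IH) simp
  qed
qed

lemma Ck_on_add:
  assumes "open S" "Ck_on k S f" "Ck_on k S g"
  shows "Ck_on k S (\<lambda>x. f x + g x)"
  using assms(2,3)
proof (induction k arbitrary: f g)
  case 0
  then show ?case by (simp add: continuous_on_add)
next
  case (Suc k)
  show ?case
  proof (rule Ck_on_SucI[OF assms(1)])
    show "((\<lambda>x. f x + g x) has_derivative
        (\<lambda>v. frechet_derivative f (at x) v + frechet_derivative g (at x) v)) (at x)"
      if "x \<in> S" for x
      by (intro has_derivative_add Ck_on_has_derivative[OF Suc.prems(1) that]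
          Ck_on_has_derivative[OF Suc.prems(2) that])
    show "Ck_on k S (\<lambda>x. frechet_derivative f (at x) v + frechet_derivative g (at x) v)" for v
      using Suc.prems by (intro Suc.IH) simp_all
  qed
qed

lemma Ck_on_sum:
  assumes "open S" "finite I" "\<And>i. i \<in> I \<Longrightarrow> Ck_on k S (f i)"
  shows "Ck_on k S (\<lambda>x. \<Sum>i\<in>I. f i x)"
  using assms(2,3) by (induction I) (auto simp: Ck_on_const intro!: Ck_on_add[OF \<open>open S\<close>])

lemma Ck_on_bounded_bilinear:
  assumes "open S" "bounded_bilinear B" "Ck_on k S f" "Ck_on k S g"
  shows "Ck_on k S (\<lambda>x. B (f x) (g x))"
  using assms(3,4)
proof (induction k arbitrary: f g)
  case 0
  then show ?case using bounded_bilinear.continuous_on[OF assms(2)] by simp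
next
  case (Suc k)
  show ?case
  proof (rule Ck_on_SucI[OF assms(1)])
    show "((\<lambda>x. B (f x) (g x)) has_derivative
        (\<lambda>v. B (f x) (frechet_derivative g (at x) v) + B (frechet_derivative f (at x) v) (g x))) (at x)"
      if "x \<in> S" for x
      by (intro bounded_bilinear.FDERIV[OF assms(2)] Ck_on_has_derivative[OF Suc.prems(1) that]
          Ck_on_has_derivative[OF Suc.prems(2) that])
    show "Ck_on k S (\<lambda>x. B (f x) (frechet_derivative g (at x) v) + B (frechet_derivative f (at x) v) (g x))"
      for v
      using Suc.prems(1,2) Ck_on_Suc_imp[OF Suc.prems(1)] Ck_on_Suc_imp[OF Suc.prems(2)]
      by (intro Ck_on_add[OF \<open>open S\<close>] Suc.IH) simp_all
  qed
qed

lemma Ck_on_Pair: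
  assumes "open S" "Ck_on k S f" "Ck_on k S g"
  shows "Ck_on k S (\<lambda>x. (f x, g x))"
proof -
  have "Ck_on k S (\<lambda>x. (f x, 0) + (0, g x))"
    by (rule Ck_on_add[OF assms(1)
          Ck_on_bounded_linear_compose[OF assms(1) bounded_linear_Pair[OF bounded_linear_ident bounded_linear_zero] assms(2)]
          Ck_on_bounded_linear_compose[OF assms(1) bounded_linear_Pair[OF bounded_linear_zero bounded_linear_ident] assms(3)]])
  then show ?thesis by simp
qed

lemma linear_eq_sum_Basis:
  fixes h :: "'b::euclidean_space \<Rightarrow> 'c::real_vector"
  assumes "linear h"
  shows "h v = (\<Sum>i\<in>Basis. (v \<bullet> i) *\<^sub>R h i)"
proof -
  have "h v = h (\<Sum>i\<in>Basis. (v \<bullet> i) *\<^sub>R i)" by (simp add: euclidean_representation)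
  then show ?thesis using assms by (simp add: linear_sum linear_cmul)
qed

text \<open>The chain rule leaves \<open>Dg(f x)(Df(x) v)\<close>, in which the direction depends on \<open>x\<close>; expanding it in the
standard basis of the intermediate space reduces the claim to products of directional derivatives.\<close>

lemma Ck_on_compose:
  fixes f :: "'b::real_normed_vector \<Rightarrow> 'c::euclidean_space"
  assumes "open S" "open T" "f ` S \<subseteq> T" "Ck_on k T g" "Ck_on k S f"
  shows "Ck_on k S (\<lambda>x. g (f x))"
  using assms(4,5)
proof (induction k arbitrary: g)
  case 0
  then show ?case using assms(3) by (auto intro: continuous_on_compose2)
next
  case (Suc k)
  have dg: "(g has_derivative frechet_derivative g (at (f x))) (at (f x))" if "x \<in> S" for x
    using that assms(3) by (intro Ck_on_has_derivative[OF Suc.prems(1)]) auto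
  show ?case
  proof (rule Ck_on_SucI[OF assms(1)])
    fix x assume x: "x \<in> S"
    have "((\<lambda>x. g (f x)) has_derivative
        (\<lambda>v. frechet_derivative g (at (f x)) (frechet_derivative f (at x) v))) (at x)"
      by (rule has_derivative_compose[OF Ck_on_has_derivative[OF Suc.prems(2) x] dg[OF x]])
    also have "(\<lambda>v. frechet_derivative g (at (f x)) (frechet_derivative f (at x) v)) =
        (\<lambda>v. \<Sum>i\<in>Basis. (frechet_derivative f (at x) v \<bullet> i) *\<^sub>R frechet_derivative g (at (f x)) i)"
      by (rule ext) (rule linear_eq_sum_Basis[OF has_derivative_linear[OF dg[OF x]]])
    finally show "((\<lambda>x. g (f x)) has_derivative
        (\<lambda>v. \<Sum>i\<in>Basis. (frechet_derivative f (at x) v \<bullet> i) *\<^sub>R frechet_derivative g (at (f x)) i)) (at x)" .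
  next
    fix v
    have "Ck_on k S (\<lambda>x. frechet_derivative g (at (f x)) i)" for i
      using Suc.prems(1) Ck_on_Suc_imp[OF Suc.prems(2)] by (intro Suc.IH) simp_all
    moreover have "Ck_on k S (\<lambda>x. frechet_derivative f (at x) v \<bullet> i)" for i
      using Suc.prems(2) by (intro Ck_on_bounded_linear_compose[OF \<open>open S\<close> bounded_linear_inner_left]) simp
    ultimately show "Ck_on k S
        (\<lambda>x. \<Sum>i\<in>Basis. (frechet_derivative f (at x) v \<bullet> i) *\<^sub>R frechet_derivative g (at (f x)) i)"
      by (intro Ck_on_sum[OF \<open>open S\<close>] Ck_on_bounded_bilinear[OF \<open>open S\<close> bounded_bilinear_scaleR]) simp_all
  qed
qed

lemma smooth_on_subset: "smooth_on S f \<Longrightarrow> T \<subseteq> S \<Longrightarrow> smooth_on T f"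
  unfolding smooth_on_def by (metis Ck_on_subset)

lemma smooth_on_cong:
  assumes "open S" "\<And>x. x \<in> S \<Longrightarrow> f x = g x"
  shows "smooth_on S f \<longleftrightarrow> smooth_on S g"
  unfolding smooth_on_def using Ck_on_cong[OF assms] by simp

lemma smooth_on_local:
  assumes "\<And>x. x \<in> S \<Longrightarrow> \<exists>U. open U \<and> x \<in> U \<and> smooth_on U f"
  shows "smooth_on S f"
  unfolding smooth_on_def by (metis Ck_on_local assms smooth_on_def)

lemma smooth_on_const [simp]: "smooth_on S (\<lambda>x. c)"
  by (simp add: smooth_on_def Ck_on_const)

lemma smooth_on_bounded_linear: "bounded_linear h \<Longrightarrow> smooth_on S h"
  by (simp add: smooth_on_def Ck_on_bounded_linear)

lemma smooth_on_bounded_linear_compose: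
  "open S \<Longrightarrow> bounded_linear h \<Longrightarrow> smooth_on S f \<Longrightarrow> smooth_on S (\<lambda>x. h (f x))"
  by (simp add: smooth_on_def Ck_on_bounded_linear_compose)

lemma smooth_on_add: "open S \<Longrightarrow> smooth_on S f \<Longrightarrow> smooth_on S g \<Longrightarrow> smooth_on S (\<lambda>x. f x + g x)"
  by (simp add: smooth_on_def Ck_on_add)

lemma smooth_on_sum:
  "open S \<Longrightarrow> finite I \<Longrightarrow> (\<And>i. i \<in> I \<Longrightarrow> smooth_on S (f i)) \<Longrightarrow> smooth_on S (\<lambda>x. \<Sum>i\<in>I. f i x)"
  by (simp add: smooth_on_def Ck_on_sum)

lemma smooth_on_bounded_bilinear:
  "open S \<Longrightarrow> bounded_bilinear B \<Longrightarrow> smooth_on S f \<Longrightarrow> smooth_on S g \<Longrightarrow> smooth_on S (\<lambda>x. B (f x) (g x))"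
  by (simp add: smooth_on_def Ck_on_bounded_bilinear)

lemma smooth_on_Pair:
  "open S \<Longrightarrow> smooth_on S f \<Longrightarrow> smooth_on S g \<Longrightarrow> smooth_on S (\<lambda>x. (f x, g x))"
  by (simp add: smooth_on_def Ck_on_Pair)

lemma smooth_on_compose:
  fixes f :: "'b::real_normed_vector \<Rightarrow> 'c::euclidean_space"
  assumes "open S" "open T" "f ` S \<subseteq> T" "smooth_on T g" "smooth_on S f"
  shows "smooth_on S (\<lambda>x. g (f x))"
  using assms by (simp add: smooth_on_def Ck_on_compose)

lemma smooth_on_differentiable: "smooth_on S f \<Longrightarrow> x \<in> S \<Longrightarrow> f differentiable (at x)"
  by (metis Ck_on.simps(2) smooth_on_def)

lemma smooth_on_has_derivative:
  "smooth_on S f \<Longrightarrow> x \<in> S \<Longrightarrow> (f has_derivative frechet_derivative f (at x)) (at x)"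
  using frechet_derivative_works smooth_on_differentiable by blast

lemma smooth_on_linear: "smooth_on S f \<Longrightarrow> x \<in> S \<Longrightarrow> linear (frechet_derivative f (at x))"
  by (simp add: linear_frechet_derivative smooth_on_differentiable)

lemma smooth_on_frechet_derivative: "smooth_on S f \<Longrightarrow> smooth_on S (\<lambda>x. frechet_derivative f (at x) v)"
  by (metis Ck_on.simps(2) smooth_on_def)

lemma smooth_on_imp_continuous_on: "smooth_on S f \<Longrightarrow> continuous_on S f"
  by (metis Ck_on.simps(1) smooth_on_def)

section \<open>Symmetry of second derivatives\<close>

text \<open>The second difference on the left is symmetric in \<open>p\<close> and \<open>q\<close>, while the right-hand side contains
the mixed derivative taken in one particular order; comparing the two orders as \<open>h\<close> tends to \<open>0\<close>
proves the symmetry of second derivatives. The formula itself is the mean value theorem applied twice,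
along \<open>p\<close> to the increments along \<open>q\<close> and then along \<open>q\<close>.\<close>

lemma second_difference_mean_value:
  fixes f :: "'b::real_normed_vector \<Rightarrow> real"
  assumes f: "smooth_on S f" and h: "h > 0"
    and S: "\<And>s t. 0 \<le> s \<Longrightarrow> s \<le> h \<Longrightarrow> 0 \<le> t \<Longrightarrow> t \<le> h \<Longrightarrow> x + s *\<^sub>R p + t *\<^sub>R q \<in> S"
  obtains s t where "0 \<le> s" "s \<le> h" "0 \<le> t" "t \<le> h"
    "f (x + h *\<^sub>R p + h *\<^sub>R q) - f (x + h *\<^sub>R p) - f (x + h *\<^sub>R q) + f x
      = h * (h * frechet_derivative (\<lambda>y. frechet_derivative f (at y) p) (at (x + s *\<^sub>R p + t *\<^sub>R q)) q)"
proof -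
  have *: "((\<lambda>s. \<phi> (y + s *\<^sub>R v)) has_real_derivative frechet_derivative \<phi> (at (y + s *\<^sub>R v)) v) (at s)"
    if "smooth_on S \<phi>" "y + s *\<^sub>R v \<in> S" for \<phi> :: "'b \<Rightarrow> real" and y s v
  proof -
    have l: "linear (frechet_derivative \<phi> (at (y + s *\<^sub>R v)))"
      using that smooth_on_linear by blast
    have "((\<lambda>s. \<phi> (y + s *\<^sub>R v)) has_derivative (\<lambda>k. frechet_derivative \<phi> (at (y + s *\<^sub>R v)) (k *\<^sub>R v))) (at s)"
      by (rule has_derivative_compose[where f="\<lambda>s. y + s *\<^sub>R v", OF _ smooth_on_has_derivative[OF that]])
         (auto intro!: derivative_eq_intros)
    then show ?thesis
      by (simp add: has_field_derivative_def linear_cmul[OF l] mult_commute_abs)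
  qed
  let ?u = "\<lambda>s. f (x + h *\<^sub>R q + s *\<^sub>R p) - f (x + s *\<^sub>R p)"
  let ?Dp = "\<lambda>y. frechet_derivative f (at y) p"
  have Dp: "smooth_on S ?Dp" using f by (rule smooth_on_frechet_derivative)
  have "\<exists>s>0. s < h \<and> ?u h - ?u 0 = (h - 0) * (?Dp (x + h *\<^sub>R q + s *\<^sub>R p) - ?Dp (x + s *\<^sub>R p))"
  proof (rule MVT2[OF h])
    fix s assume "0 \<le> s" "s \<le> h"
    then show "(?u has_real_derivative ?Dp (x + h *\<^sub>R q + s *\<^sub>R p) - ?Dp (x + s *\<^sub>R p)) (at s)"
      using S[of s h] S[of s 0] h
      by (intro DERIV_diff *[OF f]) (simp_all add: add_ac)
  qed
  then obtain s where s: "0 < s" "s < h"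
    "?u h - ?u 0 = h * (?Dp (x + h *\<^sub>R q + s *\<^sub>R p) - ?Dp (x + s *\<^sub>R p))" by auto
  have "\<exists>t>0. t < h \<and> ?Dp (x + s *\<^sub>R p + h *\<^sub>R q) - ?Dp (x + s *\<^sub>R p + 0 *\<^sub>R q)
      = (h - 0) * frechet_derivative ?Dp (at (x + s *\<^sub>R p + t *\<^sub>R q)) q"
    using s by (intro MVT2[OF h] *[OF Dp]) (auto intro: S)
  then obtain t where t: "0 < t" "t < h" "?Dp (x + s *\<^sub>R p + h *\<^sub>R q) - ?Dp (x + s *\<^sub>R p)
      = h * frechet_derivative ?Dp (at (x + s *\<^sub>R p + t *\<^sub>R q)) q" by auto
  show ?thesis
    by (rule that[of s t]) (use s t in \<open>simp_all add: add_ac\<close>)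
qed

text \<open>If the two mixed derivatives differed at \<open>x\<close>, they would by continuity stay apart near \<open>x\<close>; but by
the previous lemma the value of one of them at some point equals the value of the other at another
point, both points arbitrarily close to \<open>x\<close>.\<close>

lemma second_derivative_symmetric_real:
  fixes f :: "'b::real_normed_vector \<Rightarrow> real"
  assumes S: "open S" "x \<in> S" and f: "smooth_on S f"
  shows "frechet_derivative (\<lambda>y. frechet_derivative f (at y) p) (at x) q
       = frechet_derivative (\<lambda>y. frechet_derivative f (at y) q) (at x) p"
    (is "?A p q x = ?A q p x")
proof (rule ccontr)
  assume ne: "?A p q x \<noteq> ?A q p x"
  define d where "d = \<bar>?A p q x - ?A q p x\<bar> / 2"
  have d: "d > 0" using ne by (simp add: d_def)
  have cont: "continuous_on S (?A p q)" for p q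
    by (intro smooth_on_imp_continuous_on smooth_on_frechet_derivative f)
  have "\<exists>r>0. \<forall>y\<in>S. dist y x < r \<longrightarrow> dist (?A p q y) (?A p q x) < d" for p q
    using cont[of p q] S d by (simp add: continuous_on_iff)
  then obtain r1 r2 where r1: "r1 > 0" "\<And>y. y \<in> S \<Longrightarrow> dist y x < r1 \<Longrightarrow> dist (?A p q y) (?A p q x) < d"
    and r2: "r2 > 0" "\<And>y. y \<in> S \<Longrightarrow> dist y x < r2 \<Longrightarrow> dist (?A q p y) (?A q p x) < d"
    by metis
  obtain r3 where r3: "r3 > 0" "ball x r3 \<subseteq> S" using S openE by blast
  \<comment> \<open>Within \<open>r\<close> of \<open>x\<close> both mixed derivatives vary by less than half their supposed difference,
    and \<open>h\<close> is so small that all points occurring in the two second differences are that close.\<close>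
  define r where "r = min r1 (min r2 r3)"
  define h where "h = r / (norm p + norm q + 1)"
  have h: "h > 0" using r1 r2 r3 by (simp add: h_def r_def add_nonneg_pos)
  have near: "dist (x + s *\<^sub>R v + t *\<^sub>R w) x < r"
    if "0 \<le> s" "s \<le> h" "0 \<le> t" "t \<le> h" "{v, w} = {p, q}" for s t v w
  proof -
    have "dist (x + s *\<^sub>R v + t *\<^sub>R w) x \<le> norm (s *\<^sub>R v) + norm (t *\<^sub>R w)"
      by (simp add: dist_norm add.assoc norm_triangle_ineq del: norm_scaleR)
    also have "\<dots> \<le> h * norm v + h * norm w"
      using that by (intro add_mono) (auto intro: mult_right_mono)
    also have "\<dots> \<le> h * (norm p + norm q)"
      using that(5) h by (auto simp: doubleton_eq_iff algebra_simps)
    also have "\<dots> < h * (norm p + norm q + 1)" using h by simp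
    also have "\<dots> = r" by (simp add: h_def add_nonneg_pos less_imp_neq[symmetric])
    finally show ?thesis .
  qed
  have inS: "y \<in> S" if "dist y x < r" for y
    using that r3 by (auto simp: r_def dist_commute)
  obtain s t where st: "0 \<le> s" "s \<le> h" "0 \<le> t" "t \<le> h"
    "f (x + h *\<^sub>R p + h *\<^sub>R q) - f (x + h *\<^sub>R p) - f (x + h *\<^sub>R q) + f x
      = h * (h * ?A p q (x + s *\<^sub>R p + t *\<^sub>R q))"
    by (rule second_difference_mean_value[OF f h, of x p q]) (intro inS near; simp)
  obtain s' t' where st': "0 \<le> s'" "s' \<le> h" "0 \<le> t'" "t' \<le> h"
    "f (x + h *\<^sub>R q + h *\<^sub>R p) - f (x + h *\<^sub>R q) - f (x + h *\<^sub>R p) + f x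
      = h * (h * ?A q p (x + s' *\<^sub>R q + t' *\<^sub>R p))"
    by (rule second_difference_mean_value[OF f h, of x q p]) (intro inS near; simp add: insert_commute)
  have "f (x + h *\<^sub>R p + h *\<^sub>R q) = f (x + h *\<^sub>R q + h *\<^sub>R p)" by (simp add: add_ac)
  with st(5) st'(5) have "h * (h * ?A p q (x + s *\<^sub>R p + t *\<^sub>R q)) = h * (h * ?A q p (x + s' *\<^sub>R q + t' *\<^sub>R p))"
    by linarith
  then have eq: "?A p q (x + s *\<^sub>R p + t *\<^sub>R q) = ?A q p (x + s' *\<^sub>R q + t' *\<^sub>R p)" using h by simp
  have "dist (x + s *\<^sub>R p + t *\<^sub>R q) x < r" "dist (x + s' *\<^sub>R q + t' *\<^sub>R p) x < r"
    using st st' by (simp_all add: near insert_commute)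
  then have "dist (?A p q (x + s *\<^sub>R p + t *\<^sub>R q)) (?A p q x) < d"
    "dist (?A q p (x + s' *\<^sub>R q + t' *\<^sub>R p)) (?A q p x) < d"
    using r1(2)[OF inS] r2(2)[OF inS] by (auto simp: r_def)
  with eq have "\<bar>?A p q x - ?A q p x\<bar> < 2 * d" unfolding dist_real_def by linarith
  then show False by (simp add: d_def)
qed

lemma second_derivative_symmetric:
  fixes f :: "'b::real_normed_vector \<Rightarrow> 'c::euclidean_space"
  assumes S: "open S" "x \<in> S" and f: "smooth_on S f"
  shows "frechet_derivative (\<lambda>y. frechet_derivative f (at y) p) (at x) q
       = frechet_derivative (\<lambda>y. frechet_derivative f (at y) q) (at x) p"
proof (rule euclidean_eqI)
  fix i :: 'c assume "i \<in> Basis"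
  let ?D = "\<lambda>f y p. frechet_derivative f (at y) p"
  have inner: "?D (\<lambda>z. \<phi> z \<bullet> i) y v = ?D \<phi> y v \<bullet> i"
    if "smooth_on S \<phi>" "y \<in> S" for \<phi> :: "'b \<Rightarrow> 'c" and y v
  proof -
    have "((\<lambda>z. \<phi> z \<bullet> i) has_derivative (\<lambda>v. ?D \<phi> y v \<bullet> i)) (at y)"
      by (rule bounded_linear.has_derivative[OF bounded_linear_inner_left
            smooth_on_has_derivative[OF that]])
    from frechet_derivative_at[OF this, symmetric] show ?thesis by simp
  qed
  have "?D (\<lambda>y. ?D f y p) x q \<bullet> i = ?D (\<lambda>y. ?D (\<lambda>z. f z \<bullet> i) y p) x q" for p q
  proof -
    have sm: "smooth_on S (\<lambda>y. ?D f y p)" using f by (rule smooth_on_frechet_derivative)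
    have "?D (\<lambda>y. ?D f y p) x q \<bullet> i = ?D (\<lambda>y. ?D f y p \<bullet> i) x q"
      by (rule inner[OF sm S(2), symmetric])
    moreover have "(\<lambda>y. ?D f y p \<bullet> i) differentiable at x"
      by (rule smooth_on_differentiable[OF
            smooth_on_bounded_linear_compose[OF S(1) bounded_linear_inner_left sm] S(2)])
    from frechet_derivative_transform_within_open[OF this S, of "\<lambda>y. ?D (\<lambda>z. f z \<bullet> i) y p"]
    have "?D (\<lambda>y. ?D f y p \<bullet> i) x = ?D (\<lambda>y. ?D (\<lambda>z. f z \<bullet> i) y p) x"
      by (simp add: inner[OF f])
    ultimately show ?thesis by simp
  qed
  moreover have "smooth_on S (\<lambda>z. f z \<bullet> i)"
    by (rule smooth_on_bounded_linear_compose[OF S(1) bounded_linear_inner_left f])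
  ultimately show "?D (\<lambda>y. ?D f y p) x q \<bullet> i = ?D (\<lambda>y. ?D f y q) x p \<bullet> i"
    using second_derivative_symmetric_real[OF S, of "\<lambda>z. f z \<bullet> i" p q] by simp
qed

section \<open>Smooth maps into a manifold\<close>

lemma open_fst_vimage_slice: "open S \<Longrightarrow> open {y. (x, y) \<in> S}"
proof -
  assume "open S"
  then have "open (Pair x -` S)" by (intro open_vimage continuous_intros)
  then show ?thesis by (simp add: vimage_def)
qed

lemma open_snd_vimage_slice: "open S \<Longrightarrow> open {x. (x, y) \<in> S}"
proof -
  assume "open S"
  then have "open ((\<lambda>x. (x, y)) -` S)" by (intro open_vimage continuous_intros)
  then show ?thesis by (simp add: vimage_def)
qed

lemma smooth_on_has_derivative_snd:
  fixes f :: "'b::real_normed_vector \<times> 'c::real_normed_vector \<Rightarrow> 'd::real_normed_vector"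
  assumes "smooth_on S f" "(x, y) \<in> S"
  shows "((\<lambda>y. f (x, y)) has_derivative (\<lambda>v. frechet_derivative f (at (x, y)) (0, v))) (at y)"
  by (rule has_derivative_compose[where f="\<lambda>y. (x, y)", OF _ smooth_on_has_derivative[OF assms]])
     (auto intro!: derivative_eq_intros)

lemma smooth_on_has_derivative_fst:
  fixes f :: "'b::real_normed_vector \<times> 'c::real_normed_vector \<Rightarrow> 'd::real_normed_vector"
  assumes "smooth_on S f" "(x, y) \<in> S"
  shows "((\<lambda>x. f (x, y)) has_derivative (\<lambda>v. frechet_derivative f (at (x, y)) (v, 0))) (at x)"
  by (rule has_derivative_compose[where f="\<lambda>x. (x, y)", OF _ smooth_on_has_derivative[OF assms]])
     (auto intro!: derivative_eq_intros)

context smooth_manifold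
begin

lemma coord_param: "c \<in> A \<Longrightarrow> x \<in> chart_img c \<Longrightarrow> coord c (param c x) = x"
  using chart_homeo by (auto simp: homeomorphism_def)

lemma param_in_chart_dom: "c \<in> A \<Longrightarrow> x \<in> chart_img c \<Longrightarrow> param c x \<in> chart_dom c"
  using chart_homeo[of c] by (auto simp: homeomorphism_def)

lemma coord_in_chart_img: "p \<in> chart_dom c \<Longrightarrow> coord c p \<in> chart_img c"
  by (simp add: chart_img_def)

lemma smooth_map_on_continuous: "smooth_map_on A W h \<Longrightarrow> continuous_on W h"
  by (simp add: smooth_map_on_def)

lemma smooth_map_on_coord:
  "smooth_map_on A W h \<Longrightarrow> c \<in> A \<Longrightarrow> smooth_on (W \<inter> h -` chart_dom c) (coord c \<circ> h)"
  by (simp add: smooth_map_on_def)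

lemma open_chart_preimage:
  "open W \<Longrightarrow> smooth_map_on A W h \<Longrightarrow> c \<in> A \<Longrightarrow> open (W \<inter> h -` chart_dom c)"
  using continuous_open_preimage[OF smooth_map_on_continuous] chart_open by blast

lemma smooth_map_on_cong:
  assumes "open W" "\<And>z. z \<in> W \<Longrightarrow> h z = k z"
  shows "smooth_map_on A W h \<longleftrightarrow> smooth_map_on A W k"
proof -
  have "smooth_map_on A W k" if h: "smooth_map_on A W h" and eq: "\<And>z. z \<in> W \<Longrightarrow> h z = k z" for h k
    unfolding smooth_map_on_def
  proof (intro conjI ballI)
    show "continuous_on W k"
      using smooth_map_on_continuous[OF h] eq by (simp cong: continuous_on_cong)
    fix c assume c: "c \<in> A"
    have "W \<inter> k -` chart_dom c = W \<inter> h -` chart_dom c" using eq by auto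
    moreover have "smooth_on (W \<inter> h -` chart_dom c) (coord c \<circ> k)"
      using smooth_map_on_coord[OF h c]
        smooth_on_cong[OF open_chart_preimage[OF assms(1) h c], of "coord c \<circ> h" "coord c \<circ> k"] eq
      by simp
    ultimately show "smooth_on (W \<inter> k -` chart_dom c) (coord c \<circ> k)" by simp
  qed
  then show ?thesis using assms(2) by metis
qed

lemma smooth_map_on_local:
  assumes W: "open W" and loc: "\<And>z. z \<in> W \<Longrightarrow> \<exists>U. open U \<and> z \<in> U \<and> smooth_map_on A U h"
  shows "smooth_map_on A W h"
  unfolding smooth_map_on_def
proof (intro conjI ballI)
  have "continuous (at z) h" if "z \<in> W" for z
    using loc[OF that] smooth_map_on_continuous by (metis continuous_on_eq_continuous_at)
  then show "continuous_on W h" by (simp add: continuous_at_imp_continuous_on)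
  fix c assume c: "c \<in> A"
  show "smooth_on (W \<inter> h -` chart_dom c) (coord c \<circ> h)"
  proof (rule smooth_on_local)
    fix z assume z: "z \<in> W \<inter> h -` chart_dom c"
    then obtain U where U: "open U" "z \<in> U" "smooth_map_on A U h" using loc by blast
    show "\<exists>U. open U \<and> z \<in> U \<and> smooth_on U (coord c \<circ> h)"
      using open_chart_preimage[OF U(1,3) c] smooth_map_on_coord[OF U(3) c] z U(2) by blast
  qed
qed

lemma smooth_map_on_const: "smooth_map_on A W (\<lambda>z. p)"
  by (simp add: smooth_map_on_def o_def)

lemma smooth_map_on_compose:
  fixes \<phi> :: "'b::euclidean_space \<Rightarrow> 'c::euclidean_space"
  assumes U: "open U" and V: "open V" and h: "smooth_map_on A V h"
    and \<phi>: "smooth_on U \<phi>" "\<phi> ` U \<subseteq> V"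
  shows "smooth_map_on A U (\<lambda>z. h (\<phi> z))"
  unfolding smooth_map_on_def
proof (intro conjI ballI)
  show "continuous_on U (\<lambda>z. h (\<phi> z))"
    using smooth_map_on_continuous[OF h] smooth_on_imp_continuous_on[OF \<phi>(1)] \<phi>(2)
    by (rule continuous_on_compose2)
  fix c assume c: "c \<in> A"
  have eq: "U \<inter> (\<lambda>z. h (\<phi> z)) -` chart_dom c = U \<inter> \<phi> -` (V \<inter> h -` chart_dom c)"
    using \<phi>(2) by auto
  have "open (U \<inter> \<phi> -` (V \<inter> h -` chart_dom c))"
    by (rule continuous_open_preimage[OF smooth_on_imp_continuous_on[OF \<phi>(1)] U
          open_chart_preimage[OF V h c]])
  then have "smooth_on (U \<inter> \<phi> -` (V \<inter> h -` chart_dom c)) (\<lambda>z. (coord c \<circ> h) (\<phi> z))"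
    by (rule smooth_on_compose[OF _ open_chart_preimage[OF V h c] _ smooth_map_on_coord[OF h c]])
       (auto intro: smooth_on_subset[OF \<phi>(1)])
  then show "smooth_on (U \<inter> (\<lambda>z. h (\<phi> z)) -` chart_dom c) (coord c \<circ> (\<lambda>z. h (\<phi> z)))"
    by (simp add: eq o_def)
qed

lemma smooth_map_on_param: "c \<in> A \<Longrightarrow> smooth_map_on A (chart_img c) (param c)"
  unfolding smooth_map_on_def
proof (intro conjI ballI)
  assume c: "c \<in> A"
  show "continuous_on (chart_img c) (param c)"
    using chart_homeo[OF c] by (simp add: homeomorphism_def)
  fix d assume d: "d \<in> A"
  have "chart_img c \<inter> param c -` chart_dom d = coord c ` (chart_dom c \<inter> chart_dom d)"
    using param_coord[OF c] by (auto simp: chart_img_def image_iff) 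
  then show "smooth_on (chart_img c \<inter> param c -` chart_dom d) (coord d \<circ> param c)"
    using charts_compat[OF c d] by simp
qed

text \<open>The chain rule for a map out of the manifold that is only known to be differentiable in one chart. It
covers the change of charts, tangent maps of translations, and the passage to local coordinates.\<close>

lemma chain_through_chart:
  assumes W: "open W" "z \<in> W" and H: "smooth_map_on A W H" and c: "c \<in> A" "H z \<in> chart_dom c"
    and \<psi>: "(\<psi> \<circ> param c) differentiable (at (coord c (H z)))"
  shows "((\<psi> \<circ> H) has_derivative (\<lambda>v. frechet_derivative (\<psi> \<circ> param c) (at (coord c (H z)))
      (frechet_derivative (coord c \<circ> H) (at z) v))) (at z)"
proof -
  let ?U = "W \<inter> H -` chart_dom c"
  have U: "open ?U" by (rule open_chart_preimage[OF W(1) H c(1)])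
  have z: "z \<in> ?U" using W c by simp
  have "((\<psi> \<circ> param c) has_derivative frechet_derivative (\<psi> \<circ> param c) (at ((coord c \<circ> H) z)))
      (at ((coord c \<circ> H) z))"
    using frechet_derivative_works[THEN iffD1, OF \<psi>] by (simp only: comp_apply)
  from has_derivative_compose[OF smooth_on_has_derivative[OF smooth_map_on_coord[OF H c(1)] z] this]
  have "((\<lambda>y. (\<psi> \<circ> param c) ((coord c \<circ> H) y)) has_derivative
      (\<lambda>v. frechet_derivative (\<psi> \<circ> param c) (at ((coord c \<circ> H) z))
      (frechet_derivative (coord c \<circ> H) (at z) v))) (at z)"
    .
  then have "((\<psi> \<circ> H) has_derivative (\<lambda>v. frechet_derivative (\<psi> \<circ> param c) (at ((coord c \<circ> H) z))
      (frechet_derivative (coord c \<circ> H) (at z) v))) (at z)"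
    by (rule has_derivative_transform_within_open[OF _ U z])
       (use param_coord[OF c(1)] in auto)
  then show ?thesis by simp
qed

lemma velocity_eq_frechet_derivative:
  assumes W: "open W" "t \<in> W" and \<gamma>: "smooth_map_on A W \<gamma>"
  shows "velocity A \<gamma> t = frechet_derivative (coord (chart_at A (\<gamma> t)) \<circ> \<gamma>) (at t) 1"
proof -
  have "(coord (chart_at A (\<gamma> t)) \<circ> \<gamma>) differentiable (at t)"
    using smooth_on_differentiable[OF smooth_map_on_coord[OF \<gamma> chart_at(1)]] W chart_at(2) by blast
  then show ?thesis
    by (simp add: velocity_def frechet_derivative_eq_vector_derivative)
qed

end

section \<open>The logarithmic derivative and the Maurer--Cartan equation\<close>

context lie_group
begin

lemma smooth_map_on_mul:
  fixes p q :: "'b::euclidean_space \<Rightarrow> 'a"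
  assumes W: "open W" and p: "smooth_map_on A W p" and q: "smooth_map_on A W q"
  shows "smooth_map_on A W (\<lambda>z. mul (p z) (q z))"
proof (rule smooth_map_on_local[OF W])
  fix z assume z: "z \<in> W"
  let ?c = "chart_at A (p z)" and ?d = "chart_at A (q z)"
  let ?U = "(W \<inter> p -` chart_dom ?c) \<inter> (W \<inter> q -` chart_dom ?d)"
  have U: "open ?U" by (intro open_Int[of "_ \<inter> _"] open_chart_preimage W p q chart_at)
  have "smooth_map_on A ?U (\<lambda>z. (\<lambda>(x, y). mul (param ?c x) (param ?d y)) ((coord ?c \<circ> p) z, (coord ?d \<circ> q) z))"
  proof (rule smooth_map_on_compose[OF U _ smooth_mult[OF chart_at(1) chart_at(1)]])
    show "open (chart_img ?c \<times> chart_img ?d)" by (intro open_Times chart_img_open chart_at)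
    show "smooth_on ?U (\<lambda>z. ((coord ?c \<circ> p) z, (coord ?d \<circ> q) z))"
      by (rule smooth_on_Pair[OF U]; rule smooth_on_subset[OF smooth_map_on_coord])
         (use p q chart_at in auto)
  qed (auto intro: coord_in_chart_img)
  then have "smooth_map_on A ?U (\<lambda>z. mul (p z) (q z))"
    by (subst smooth_map_on_cong[OF U, symmetric]) (auto simp: param_coord chart_at)
  then show "\<exists>U. open U \<and> z \<in> U \<and> smooth_map_on A U (\<lambda>z. mul (p z) (q z))"
    using U z chart_at by blast
qed

lemma smooth_map_on_ginv:
  fixes p :: "'b::euclidean_space \<Rightarrow> 'a"
  assumes W: "open W" and p: "smooth_map_on A W p"
  shows "smooth_map_on A W (\<lambda>z. ginv (p z))"
proof (rule smooth_map_on_local[OF W])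
  fix z assume z: "z \<in> W"
  let ?c = "chart_at A (p z)"
  let ?U = "W \<inter> p -` chart_dom ?c"
  have U: "open ?U" by (intro open_chart_preimage W p chart_at)
  have "smooth_map_on A ?U (\<lambda>z. (\<lambda>x. ginv (param ?c x)) ((coord ?c \<circ> p) z))"
    by (rule smooth_map_on_compose[OF U chart_img_open[OF chart_at(1)] smooth_inv[OF chart_at(1)]
          smooth_map_on_coord[OF p chart_at(1)]]) (auto intro: coord_in_chart_img)
  then have "smooth_map_on A ?U (\<lambda>z. ginv (p z))"
    by (subst smooth_map_on_cong[OF U, symmetric]) (auto simp: param_coord chart_at)
  then show "\<exists>U. open U \<and> z \<in> U \<and> smooth_map_on A U (\<lambda>z. ginv (p z))"
    using U z chart_at by blast
qed

definition unit_chart :: "('a, 'e) chart" where "unit_chart = chart_at A one"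
definition unit_coord :: 'e where "unit_coord = coord unit_chart one"

lemma unit_chart: "unit_chart \<in> A" "one \<in> chart_dom unit_chart" "param unit_chart unit_coord = one"
    "unit_coord \<in> chart_img unit_chart" "coord unit_chart one = unit_coord"
  using chart_at param_coord by (auto simp: unit_chart_def unit_coord_def intro: coord_in_chart_img)

text \<open>The displacement from \<open>H z\<close> to \<open>H y\<close>, brought back to the identity and read in a chart there. Its
derivatives on the diagonal carry all the first and second order information that is needed.\<close>

definition rel_coord :: "('b::euclidean_space \<Rightarrow> 'a) \<Rightarrow> 'b \<times> 'b \<Rightarrow> 'e" where
  "rel_coord H = (\<lambda>(z, y). coord unit_chart (mul (ginv (H z)) (H y)))"

text \<open>The pairs whose displacement lies in the chart around the identity: an open neighbourhood of the
diagonal.\<close>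

definition rel_dom :: "'b::euclidean_space set \<Rightarrow> ('b \<Rightarrow> 'a) \<Rightarrow> ('b \<times> 'b) set" where
  "rel_dom W H = {(z, y). z \<in> W \<and> y \<in> W \<and> mul (ginv (H z)) (H y) \<in> chart_dom unit_chart}"

text \<open>The pullback by \<open>H\<close> of the left Maurer--Cartan form, also called the left logarithmic derivative: it
sends \<open>v\<close> to the left translate to the Lie algebra of the derivative of \<open>H\<close> in direction \<open>v\<close>.\<close>

definition dlog :: "('b::euclidean_space \<Rightarrow> 'a) \<Rightarrow> 'b \<Rightarrow> 'b \<Rightarrow> 'e" where
  "dlog H z = frechet_derivative (\<lambda>y. rel_coord H (z, y)) (at z)"

definition mul_coord :: "'e \<times> 'e \<Rightarrow> 'e" where
  "mul_coord = (\<lambda>(x, y). coord unit_chart (mul (param unit_chart x) (param unit_chart y)))"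

definition mul_dom :: "('e \<times> 'e) set" where
  "mul_dom = {(x, y). x \<in> chart_img unit_chart \<and> y \<in> chart_img unit_chart
      \<and> mul (param unit_chart x) (param unit_chart y) \<in> chart_dom unit_chart}"

lemma rel_coord_smooth:
  assumes W: "open W" and H: "smooth_map_on A W H"
  shows "open (rel_dom W H)" "smooth_on (rel_dom W H) (rel_coord H)"
proof -
  let ?N = "\<lambda>zy. mul (ginv (H (fst zy))) (H (snd zy))"
  have WW: "open (W \<times> W)" using W by (intro open_Times)
  have "smooth_map_on A (W \<times> W) (\<lambda>zy. H (fst zy))" "smooth_map_on A (W \<times> W) (\<lambda>zy. H (snd zy))"
    by (rule smooth_map_on_compose[OF WW W H]; auto intro: smooth_on_bounded_linear bounded_linear_fst bounded_linear_snd)+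
  then have N: "smooth_map_on A (W \<times> W) ?N"
    by (intro smooth_map_on_mul smooth_map_on_ginv WW)
  have eq: "rel_dom W H = (W \<times> W) \<inter> ?N -` chart_dom unit_chart" by (auto simp: rel_dom_def)
  have "rel_coord H = coord unit_chart \<circ> ?N" by (auto simp: rel_coord_def)
  then show "open (rel_dom W H)" "smooth_on (rel_dom W H) (rel_coord H)"
    using open_chart_preimage[OF WW N unit_chart(1)] smooth_map_on_coord[OF N unit_chart(1)] by (auto simp: eq)
qed

lemma rel_dom_diag: "z \<in> W \<Longrightarrow> (z, z) \<in> rel_dom W H" "rel_coord H (z, z) = unit_coord"
  by (auto simp: rel_dom_def rel_coord_def unit_chart)

lemma mul_coord_smooth: "open mul_dom" "smooth_on mul_dom mul_coord"
proof -
  let ?N = "\<lambda>(x, y). mul (param unit_chart x) (param unit_chart y)"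
  have W: "open (chart_img unit_chart \<times> chart_img unit_chart)"
    by (intro open_Times chart_img_open unit_chart)
  have N: "smooth_map_on A (chart_img unit_chart \<times> chart_img unit_chart) ?N"
    by (rule smooth_mult[OF unit_chart(1) unit_chart(1)])
  have eq: "mul_dom = (chart_img unit_chart \<times> chart_img unit_chart) \<inter> ?N -` chart_dom unit_chart"
    by (auto simp: mul_dom_def)
  have "mul_coord = coord unit_chart \<circ> ?N" by (auto simp: mul_coord_def)
  then show "open mul_dom" "smooth_on mul_dom mul_coord"
    using open_chart_preimage[OF W N unit_chart(1)] smooth_map_on_coord[OF N unit_chart(1)] by (auto simp: eq)
qed

lemma mul_dom_unit_coord: "x \<in> chart_img unit_chart \<Longrightarrow> (x, unit_coord) \<in> mul_dom"
  by (simp add: mul_dom_def unit_chart param_in_chart_dom)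

lemma dlog_has_derivative:
  assumes W: "open W" "z \<in> W" and H: "smooth_map_on A W H"
  shows "((\<lambda>y. rel_coord H (z, y)) has_derivative dlog H z) (at z)"
    and "dlog H z v = frechet_derivative (rel_coord H) (at (z, z)) (0, v)"
proof -
  have d: "((\<lambda>y. rel_coord H (z, y)) has_derivative
      (\<lambda>v. frechet_derivative (rel_coord H) (at (z, z)) (0, v))) (at z)"
    by (rule smooth_on_has_derivative_snd[OF rel_coord_smooth(2)[OF W(1) H] rel_dom_diag(1)[OF W(2)]])
  have eq: "dlog H z = (\<lambda>v. frechet_derivative (rel_coord H) (at (z, z)) (0, v))"
    unfolding dlog_def using frechet_derivative_at[OF d] by simp
  show "((\<lambda>y. rel_coord H (z, y)) has_derivative dlog H z) (at z)" using d eq by simp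
  show "dlog H z v = frechet_derivative (rel_coord H) (at (z, z)) (0, v)" using eq by simp
qed

lemma linear_dlog:
  assumes W: "open W" "z \<in> W" and H: "smooth_map_on A W H"
  shows "linear (dlog H z)"
  using dlog_has_derivative(1)[OF assms] has_derivative_linear by blast

text \<open>The displacement is constant along the diagonal, so its two partial derivatives there cancel.\<close>

lemma rel_coord_derivative_fst:
  assumes W: "open W" "z \<in> W" and H: "smooth_map_on A W H"
  shows "frechet_derivative (rel_coord H) (at (z, z)) (v, 0) = - dlog H z v"
proof -
  let ?D = "frechet_derivative (rel_coord H) (at (z, z))"
  have sm: "smooth_on (rel_dom W H) (rel_coord H)" "(z, z) \<in> rel_dom W H"
    using rel_coord_smooth(2)[OF W(1) H] rel_dom_diag(1)[OF W(2)] .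
  have d1: "((\<lambda>y. rel_coord H (y, y)) has_derivative (\<lambda>v. ?D (v, v))) (at z)"
    by (rule has_derivative_compose[where f="\<lambda>y. (y, y)", OF _ smooth_on_has_derivative[OF sm]])
       (auto intro!: derivative_eq_intros)
  have d2: "((\<lambda>y. rel_coord H (y, y)) has_derivative (\<lambda>v. 0)) (at z)"
    by (simp add: rel_dom_diag)
  have "?D (v, v) = 0"
    by (rule fun_cong[OF has_derivative_unique[OF d1 d2]])
  moreover have "?D ((v, 0) + (0, v)) = ?D (v, 0) + ?D (0, v)"
    using smooth_on_linear[OF sm] by (simp only: linear_add)
  ultimately show ?thesis using dlog_has_derivative(2)[OF assms, of v]
    by (simp add: eq_neg_iff_add_eq_0)
qed

lemma dlog_smooth:
  assumes W: "open W" and H: "smooth_map_on A W H"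
  shows "smooth_on W (\<lambda>z. dlog H z v)"
proof -
  have "smooth_on W (\<lambda>z. frechet_derivative (rel_coord H) (at (z, z)) (0, v))"
    using rel_dom_diag(1)[of _ W H]
    by (intro smooth_on_compose[where f="\<lambda>z. (z, z)", OF W rel_coord_smooth(1)[OF W H] _
          smooth_on_frechet_derivative[OF rel_coord_smooth(2)[OF W H]]]
        smooth_on_bounded_linear bounded_linear_Pair bounded_linear_ident) auto
  then show ?thesis
    by (subst smooth_on_cong[OF W dlog_has_derivative(2)[OF W _ H]])
qed

text \<open>The mixed second derivative of the multiplication at the identity; its antisymmetric part is the Lie
bracket (see \<open>lie_bracket_eq\<close> below).\<close>

definition mul_hess :: "'e \<Rightarrow> 'e \<Rightarrow> 'e" where
  "mul_hess u v = frechet_derivative (\<lambda>x. frechet_derivative mul_coord (at x) (0, v)) (at (unit_coord, unit_coord)) (u, 0)"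

lemma unit_coord_mul_dom: "(unit_coord, unit_coord) \<in> mul_dom"
  by (simp add: mul_dom_unit_coord unit_chart)

lemma mul_hess_has_derivative:
  "((\<lambda>x. frechet_derivative mul_coord (at (x, unit_coord)) (0, v)) has_derivative (\<lambda>u. mul_hess u v)) (at unit_coord)"
  unfolding mul_hess_def
  by (rule smooth_on_has_derivative_fst[OF smooth_on_frechet_derivative[OF mul_coord_smooth(2)] unit_coord_mul_dom])

text \<open>Linearity in \<open>v\<close> is the linearity of a derivative once the order of differentiation is exchanged.\<close>

lemma linear_mul_hess: "linear (\<lambda>u. mul_hess u v)" "linear (mul_hess u)"
proof -
  show "linear (\<lambda>u. mul_hess u v)" using mul_hess_has_derivative has_derivative_linear by blast
  have "mul_hess u v = frechet_derivative (\<lambda>x. frechet_derivative mul_coord (at x) (u, 0)) (at (unit_coord, unit_coord)) (0, v)" for v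
    unfolding mul_hess_def
    by (rule second_derivative_symmetric[OF mul_coord_smooth(1) unit_coord_mul_dom mul_coord_smooth(2)])
  then have eq: "mul_hess u = (\<lambda>v. frechet_derivative (\<lambda>x. frechet_derivative mul_coord (at x) (u, 0)) (at (unit_coord, unit_coord)) (0, v))"
    by (rule ext)
  show "linear (mul_hess u)" unfolding eq
    by (rule has_derivative_linear[OF smooth_on_has_derivative_snd[OF
            smooth_on_frechet_derivative[OF mul_coord_smooth(2)] unit_coord_mul_dom]])
qed

text \<open>The displacement from \<open>H z\<close> to \<open>H y\<close> is the product of those from \<open>H z\<close> to \<open>H w\<close> and from \<open>H w\<close> to
\<open>H y\<close>. This transports second order questions at an arbitrary point to the identity.\<close>

lemma rel_coord_mul_coord:
  assumes "(z, w) \<in> rel_dom W H" "(w, y) \<in> rel_dom W H"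
  shows "rel_coord H (z, y) = mul_coord (rel_coord H (z, w), rel_coord H (w, y))"
proof -
  have "mul (mul (ginv (H z)) (H w)) (mul (ginv (H w)) (H y)) = mul (ginv (H z)) (mul (mul (H w) (ginv (H w))) (H y))"
    by (simp only: assoc)
  also have "\<dots> = mul (ginv (H z)) (H y)" by (simp add: group_left_neutral)
  finally show ?thesis
    using assms by (simp add: rel_coord_def mul_coord_def rel_dom_def param_coord[OF unit_chart(1)])
qed

text \<open>Factoring the displacement through the base point \<open>z\<close> expresses it by the multiplication in the unit
chart. The first factor contributes \<open>- dlog H z u\<close>, whence the sign.\<close>

lemma rel_coord_mixed_derivative:
  assumes W: "open W" "z \<in> W" and H: "smooth_map_on A W H"
  shows "frechet_derivative (\<lambda>x. frechet_derivative (rel_coord H) (at x) (0, v)) (at (z, z)) (u, 0)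
    = - mul_hess (dlog H z u) (dlog H z v)"
proof -
  let ?R = "rel_coord H" and ?Dm = "\<lambda>w. rel_dom W H"
  note sm = rel_coord_smooth[OF W(1) H]
  have zz: "(z, z) \<in> rel_dom W H" by (rule rel_dom_diag(1)[OF W(2)])
  have R_img: "?R x \<in> chart_img unit_chart" if "x \<in> rel_dom W H" for x
    using that by (auto simp: rel_dom_def rel_coord_def intro: coord_in_chart_img)
  \<comment> \<open>Near \<open>z\<close> the second-argument derivative is that of the multiplication, at a moving first factor;
    it remains to differentiate in that factor.\<close>
  define U where "U = {w. (w, z) \<in> rel_dom W H}"
  have U: "open U" "z \<in> U" using open_snd_vimage_slice[OF sm(1)] zz by (auto simp: U_def)
  have eq: "frechet_derivative ?R (at (w, z)) (0, v)
      = frechet_derivative mul_coord (at (?R (w, z), unit_coord)) (0, dlog H z v)" if w: "w \<in> U" for w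
  proof -
    let ?V = "{y. (w, y) \<in> rel_dom W H} \<inter> {y. (z, y) \<in> rel_dom W H}"
    have wz: "(w, z) \<in> rel_dom W H" using w by (simp add: U_def)
    have V: "open ?V" "z \<in> ?V"
      using open_fst_vimage_slice[OF sm(1)] wz zz by auto
    have d1: "((\<lambda>y. ?R (w, y)) has_derivative (\<lambda>v. frechet_derivative ?R (at (w, z)) (0, v))) (at z)"
      by (rule smooth_on_has_derivative_snd[OF sm(2) wz])
    have "((\<lambda>y. (?R (w, z), ?R (z, y))) has_derivative (\<lambda>v. (0, dlog H z v))) (at z)"
      by (intro has_derivative_Pair has_derivative_const dlog_has_derivative[OF W H])
    moreover have "(mul_coord has_derivative frechet_derivative mul_coord (at (?R (w, z), ?R (z, z))))
        (at (?R (w, z), ?R (z, z)))"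
      by (rule smooth_on_has_derivative[OF mul_coord_smooth(2)])
         (simp add: rel_dom_diag mul_dom_unit_coord R_img[OF wz])
    ultimately have "((\<lambda>y. mul_coord (?R (w, z), ?R (z, y))) has_derivative
        (\<lambda>v. frechet_derivative mul_coord (at (?R (w, z), ?R (z, z))) (0, dlog H z v))) (at z)"
      by (rule has_derivative_compose)
    then have "((\<lambda>y. ?R (w, y)) has_derivative
        (\<lambda>v. frechet_derivative mul_coord (at (?R (w, z), ?R (z, z))) (0, dlog H z v))) (at z)"
      by (rule has_derivative_transform_within_open[OF _ V])
         (use rel_coord_mul_coord[OF wz] in auto)
    from fun_cong[OF has_derivative_unique[OF d1 this], of v] show ?thesis by (simp only: rel_dom_diag(2))
  qed
  have d1: "((\<lambda>w. frechet_derivative ?R (at (w, z)) (0, v)) has_derivative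
      (\<lambda>u. frechet_derivative (\<lambda>x. frechet_derivative ?R (at x) (0, v)) (at (z, z)) (u, 0))) (at z)"
    by (rule smooth_on_has_derivative_fst[OF smooth_on_frechet_derivative[OF sm(2)] zz])
  have d2: "((\<lambda>w. frechet_derivative ?R (at (w, z)) (0, v)) has_derivative
      (\<lambda>u. mul_hess (- dlog H z u) (dlog H z v))) (at z)"
  proof (rule has_derivative_transform_within_open[OF _ U eq[symmetric]])
    have "((\<lambda>w. ?R (w, z)) has_derivative (\<lambda>u. - dlog H z u)) (at z)"
      using smooth_on_has_derivative_fst[OF sm(2) zz] rel_coord_derivative_fst[OF W H] by simp
    then show "((\<lambda>w. frechet_derivative mul_coord (at (?R (w, z), unit_coord)) (0, dlog H z v)) has_derivative
        (\<lambda>u. mul_hess (- dlog H z u) (dlog H z v))) (at z)"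
      by (rule has_derivative_compose) (simp add: rel_dom_diag mul_hess_has_derivative)
  qed
  have "frechet_derivative (\<lambda>x. frechet_derivative ?R (at x) (0, v)) (at (z, z)) (u, 0)
      = mul_hess (- dlog H z u) (dlog H z v)"
    by (rule fun_cong[OF has_derivative_unique[OF d1 d2]])
  then show ?thesis using linear_neg[OF linear_mul_hess(1)] by simp
qed

text \<open>In the unit chart the left invariant field of \<open>\<zeta>\<close> is the partial derivative of the multiplication in
its second argument, at the identity in direction \<open>\<zeta>\<close>; the coordinate formula for the bracket then
differentiates it once more, in the first argument.\<close>

lemma lie_bracket_eq: "lie_bracket A mul one \<zeta> \<omega> = mul_hess \<zeta> \<omega> - mul_hess \<omega> \<zeta>"
proof -
  have loc: "to_chart A unit_chart (param unit_chart x) (left_inv_field A mul one \<zeta> (param unit_chart x))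
      = frechet_derivative mul_coord (at (x, unit_coord)) (0, \<zeta>)" if x: "x \<in> chart_img unit_chart" for x \<zeta>
  proof -
    define p where "p = param unit_chart x"
    let ?k = "chart_at A p"
    let ?h = "\<lambda>y. mul p (param unit_chart y)"
    have W: "open (chart_img unit_chart)" by (rule chart_img_open[OF unit_chart(1)])
    have h: "smooth_map_on A (chart_img unit_chart) ?h"
      by (intro smooth_map_on_mul smooth_map_on_const smooth_map_on_param W unit_chart)
    have hx: "?h unit_coord = p" by (simp add: unit_chart)
    have pc: "p \<in> chart_dom unit_chart" using param_in_chart_dom[OF unit_chart(1) x] by (simp add: p_def)
    have "(coord unit_chart \<circ> param ?k) differentiable (at (coord ?k p))"
      by (rule smooth_on_differentiable[OF charts_compat[OF chart_at(1) unit_chart(1)]])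
         (use chart_at(2) pc in auto)
    then have d1: "((coord unit_chart \<circ> ?h) has_derivative (\<lambda>v. frechet_derivative (coord unit_chart \<circ> param ?k) (at (coord ?k p))
        (frechet_derivative (coord ?k \<circ> ?h) (at unit_coord) v))) (at unit_coord)"
      using chain_through_chart[OF W unit_chart(4) h chart_at(1), of p "coord unit_chart"] chart_at(2)[of p]
      by (simp add: hx)
    have d2: "((\<lambda>y. mul_coord (x, y)) has_derivative (\<lambda>v. frechet_derivative mul_coord (at (x, unit_coord)) (0, v))) (at unit_coord)"
      by (rule smooth_on_has_derivative_snd[OF mul_coord_smooth(2) mul_dom_unit_coord[OF x]])
    have "(\<lambda>y. mul_coord (x, y)) = coord unit_chart \<circ> ?h"
      by (auto simp: mul_coord_def p_def)
    note d2 = d2[unfolded this]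
    have "frechet_derivative (coord unit_chart \<circ> param ?k) (at (coord ?k p))
        (frechet_derivative (coord ?k \<circ> ?h) (at unit_coord) \<zeta>) = frechet_derivative mul_coord (at (x, unit_coord)) (0, \<zeta>)"
      by (rule fun_cong[OF has_derivative_unique[OF d1 d2]])
    moreover have "coord ?k \<circ> mul p \<circ> param unit_chart = coord ?k \<circ> ?h" by auto
    ultimately show ?thesis
      by (simp add: p_def[symmetric] to_chart_def coord_change_def left_inv_field_def tangent_map_def
          unit_chart_def[symmetric] unit_coord_def[symmetric])
  qed
  have "frechet_derivative (\<lambda>x. to_chart A unit_chart (param unit_chart x) (left_inv_field A mul one \<zeta> (param unit_chart x)))
      (at unit_coord) = (\<lambda>u. mul_hess u \<zeta>)" for \<zeta>
  proof (rule frechet_derivative_at[symmetric])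
    show "((\<lambda>x. to_chart A unit_chart (param unit_chart x) (left_inv_field A mul one \<zeta> (param unit_chart x)))
        has_derivative (\<lambda>u. mul_hess u \<zeta>)) (at unit_coord)"
      by (rule has_derivative_transform_within_open[OF mul_hess_has_derivative
            chart_img_open[OF unit_chart(1)] unit_chart(4) loc[symmetric]])
  qed
  then show ?thesis
    by (simp add: lie_bracket_def vf_bracket_def Let_def unit_chart_def[symmetric] unit_coord_def[symmetric])
       (simp add: left_inv_field_def tangent_map_one)
qed

text \<open>The derivative of \<open>dlog H z v\<close> along \<open>u\<close> is a second derivative of the displacement, the base point
moving along the diagonal. It splits into a mixed part, known in terms of \<open>mul_hess\<close>, and a part in
which both derivatives act on the second argument. The latter is symmetric in \<open>u\<close> and \<open>v\<close> and cancels.\<close>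

lemma maurer_cartan:
  assumes W: "open W" "z \<in> W" and H: "smooth_map_on A W H"
  shows "frechet_derivative (\<lambda>z. dlog H z v) (at z) u - frechet_derivative (\<lambda>z. dlog H z u) (at z) v
    = - lie_bracket A mul one (dlog H z u) (dlog H z v)"
proof -
  let ?R = "rel_coord H"
  let ?S = "\<lambda>p q. frechet_derivative (\<lambda>x. frechet_derivative ?R (at x) q) (at (z, z)) p"
  note sm = rel_coord_smooth[OF W(1) H]
  have zz: "(z, z) \<in> rel_dom W H" by (rule rel_dom_diag(1)[OF W(2)])
  have "frechet_derivative (\<lambda>z. dlog H z v) (at z) u = - mul_hess (dlog H z u) (dlog H z v) + ?S (0, u) (0, v)" for u v
  proof -
    have "((\<lambda>y. frechet_derivative ?R (at (y, y)) (0, v)) has_derivative (\<lambda>u. ?S (u, u) (0, v))) (at z)"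
      by (rule has_derivative_compose[where f="\<lambda>y. (y, y)", OF _ smooth_on_has_derivative[OF
              smooth_on_frechet_derivative[OF sm(2)] zz]])
         (auto intro!: derivative_eq_intros)
    then have "((\<lambda>y. dlog H y v) has_derivative (\<lambda>u. ?S (u, u) (0, v))) (at z)"
      by (rule has_derivative_transform_within_open[OF _ W])
         (use dlog_has_derivative(2)[OF W(1) _ H] in simp)
    from fun_cong[OF frechet_derivative_at[OF this], of u]
    have "frechet_derivative (\<lambda>z. dlog H z v) (at z) u = ?S (u, u) (0, v)" by (rule sym)
    also have "\<dots> = ?S ((u, 0) + (0, u)) (0, v)" by simp
    also have "\<dots> = ?S (u, 0) (0, v) + ?S (0, u) (0, v)"
      by (rule linear_add[OF smooth_on_linear[OF smooth_on_frechet_derivative[OF sm(2)] zz]])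
    finally show ?thesis by (simp only: rel_coord_mixed_derivative[OF W H])
  qed
  moreover have "?S (0, u) (0, v) = ?S (0, v) (0, u)"
    by (rule second_derivative_symmetric[OF sm(1) zz sm(2)])
  ultimately show ?thesis by (simp add: lie_bracket_eq)
qed

lemma dlog_chain:
  assumes W: "open W" "z \<in> W" and H: "smooth_map_on A W H" and c: "c \<in> A" "H z \<in> chart_dom c"
  shows "dlog H z v = frechet_derivative (coord unit_chart \<circ> mul (ginv (H z)) \<circ> param c) (at (coord c (H z)))
      (frechet_derivative (coord c \<circ> H) (at z) v)"
proof -
  have "(coord unit_chart \<circ> mul (ginv (H z)) \<circ> param c) differentiable (at (coord c (H z)))"
    by (rule left_translation_differentiable[OF c unit_chart(1)]) (simp add: unit_chart)
  from chain_through_chart[OF W H c this]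
  have "((coord unit_chart \<circ> mul (ginv (H z)) \<circ> H) has_derivative (\<lambda>v.
     frechet_derivative (coord unit_chart \<circ> mul (ginv (H z)) \<circ> param c) (at (coord c (H z)))
      (frechet_derivative (coord c \<circ> H) (at z) v))) (at z)" .
  moreover have "coord unit_chart \<circ> mul (ginv (H z)) \<circ> H = (\<lambda>y. rel_coord H (z, y))"
    by (auto simp: rel_coord_def)
  ultimately have d: "((\<lambda>y. rel_coord H (z, y)) has_derivative (\<lambda>v.
     frechet_derivative (coord unit_chart \<circ> mul (ginv (H z)) \<circ> param c) (at (coord c (H z)))
      (frechet_derivative (coord c \<circ> H) (at z) v))) (at z)" by (simp only:)
  show ?thesis
    by (rule fun_cong[OF has_derivative_unique[OF dlog_has_derivative(1)[OF W H] d]])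
qed

text \<open>The link to the tangent maps of the manifold: components of the derivative of \<open>H\<close> in the chart
selected at \<open>H z\<close> are sent by left translation to \<open>dlog H z v\<close>.\<close>

lemma tangent_map_velocity_eq_dlog:
  assumes W: "open W" "z \<in> W" and H: "smooth_map_on A W H"
  shows "tangent_map A (mul (ginv (H z))) (H z) (frechet_derivative (coord (chart_at A (H z)) \<circ> H) (at z) v)
    = dlog H z v"
  using dlog_chain[OF W H chart_at] by (simp add: tangent_map_def unit_chart_def)

lemma dlog_param:
  "dlog (param c) x v = frechet_derivative (coord unit_chart \<circ> mul (ginv (param c x)) \<circ> param c) (at x) v"
  by (simp add: dlog_def rel_coord_def o_def)

text \<open>In coordinates, \<open>dlog H\<close> is the form of the chart evaluated on the coordinate velocity. With \<open>H\<close> a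
curve this is \<open>\<xi> = \<Phi>(q) q'\<close> for \<open>\<Phi> = dlog (param c)\<close>.\<close>

lemma dlog_chain_param:
  assumes W: "open W" "z \<in> W" and H: "smooth_map_on A W H" and c: "c \<in> A" "H z \<in> chart_dom c"
  shows "dlog H z v = dlog (param c) (coord c (H z)) (frechet_derivative (coord c \<circ> H) (at z) v)"
  using dlog_chain[OF assms] dlog_param[of c "coord c (H z)"] param_coord[OF c] by simp

lemma tangent_map_from_chart_eq_dlog:
  assumes c: "c \<in> A" "x \<in> chart_img c"
  shows "tangent_map A (mul (ginv (param c x))) (param c x) (from_chart A c (param c x) v) = dlog (param c) x v"
  using tangent_map_velocity_eq_dlog[OF chart_img_open[OF c(1)] c(2) smooth_map_on_param[OF c(1)]]
  by (simp add: from_chart_def coord_change_def coord_param[OF c])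

lemma dlog_compose:
  assumes W: "open W" "j s \<in> W" and H: "smooth_map_on A W H" and j: "(j has_derivative j') (at s)"
  shows "dlog (\<lambda>y. H (j y)) s v = dlog H (j s) (j' v)"
proof -
  have "((\<lambda>y. rel_coord H (j s, j y)) has_derivative (\<lambda>v. dlog H (j s) (j' v))) (at s)"
    by (rule has_derivative_compose[OF j dlog_has_derivative(1)[OF W H]])
  then have "((\<lambda>y. rel_coord (\<lambda>y. H (j y)) (s, y)) has_derivative (\<lambda>v. dlog H (j s) (j' v))) (at s)"
    by (simp add: rel_coord_def)
  from fun_cong[OF frechet_derivative_at[OF this], of v] show ?thesis
    by (simp add: dlog_def[of "\<lambda>y. H (j y)"])
qed

lemma dlog_cong:
  assumes W: "open W" "z \<in> W" and H: "smooth_map_on A W H" and U: "open U" "z \<in> U"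
    and eq: "\<And>y. y \<in> U \<Longrightarrow> H y = H' y"
  shows "dlog H z v = dlog H' z v"
proof -
  have "((\<lambda>y. rel_coord H' (z, y)) has_derivative dlog H z) (at z)"
    by (rule has_derivative_transform_within_open[OF dlog_has_derivative(1)[OF W H] U])
       (simp add: rel_coord_def eq U)
  from fun_cong[OF frechet_derivative_at[OF this], of v] show ?thesis
    by (simp add: dlog_def[of H'])
qed

lemma dlog_const: "dlog (\<lambda>y. p) z v = 0"
  by (simp add: dlog_def rel_coord_def)

lemma body_velocity_dlog:
  assumes W: "open W" "t \<in> W" and \<gamma>: "smooth_map_on A W \<gamma>"
  shows "body_velocity A mul ginv \<gamma> t = dlog \<gamma> t 1"
  unfolding body_velocity_def velocity_eq_frechet_derivative[OF assms]
  by (rule tangent_map_velocity_eq_dlog[OF assms])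

end

section \<open>Restriction to the Lie algebra\<close>

lemma has_vector_derivative_iff_vector_derivative:
  "(\<phi> has_vector_derivative D) (at t) \<longleftrightarrow> \<phi> differentiable (at t) \<and> vector_derivative \<phi> (at t) = D"
  using vector_derivative_at vector_derivative_works differentiableI_vector by metis

lemma smooth_on_vector_derivative:
  fixes \<gamma> :: "real \<Rightarrow> 'b::real_normed_vector"
  assumes "open S" "smooth_on S \<gamma>"
  shows "smooth_on S (\<lambda>t. vector_derivative \<gamma> (at t))"
proof -
  have "vector_derivative \<gamma> (at t) = frechet_derivative \<gamma> (at t) 1" if "t \<in> S" for t
    by (simp add: frechet_derivative_eq_vector_derivative[OF smooth_on_differentiable[OF assms(2) that]])
  then show ?thesis
    using smooth_on_cong[OF assms(1), of "\<lambda>t. vector_derivative \<gamma> (at t)" "\<lambda>t. frechet_derivative \<gamma> (at t) 1"]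
      smooth_on_frechet_derivative[OF assms(2)] by simp
qed

lemma smooth_on_has_vector_derivative:
  fixes \<gamma> :: "real \<Rightarrow> 'b::real_normed_vector"
  assumes "smooth_on S \<gamma>" "t \<in> S"
  shows "(\<gamma> has_vector_derivative vector_derivative \<gamma> (at t)) (at t)"
  using smooth_on_differentiable[OF assms] vector_derivative_works by blast

text \<open>Reduces smoothness of a curve of covectors to smoothness of its finitely many components.\<close>

lemma blinfun_basis_expansion:
  fixes \<alpha> :: "'e::euclidean_space \<Rightarrow>\<^sub>L real"
  shows "\<alpha> = (\<Sum>i\<in>Basis. blinfun_apply \<alpha> i *\<^sub>R blinfun_inner_left i)"
  by (rule blinfun_euclidean_eqI)
     (simp add: blinfun.sum_left blinfun.scaleR_left inner_Basis if_distrib cong: if_cong)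

lemma dl_apply:
  fixes l :: "'e::euclidean_space \<Rightarrow> real"
  assumes "l differentiable (at x)"
  shows "blinfun_apply (dl l x) v = frechet_derivative l (at x) v"
  unfolding dl_def
  using assms frechet_derivative_works has_derivative_bounded_linear
  by (metis bounded_linear_Blinfun_apply)

lemma smooth_on_dl:
  fixes l :: "'e::euclidean_space \<Rightarrow> real"
  assumes l: "smooth_on UNIV l"
  shows "smooth_on UNIV (dl l)"
proof -
  have "dl l x = (\<Sum>i\<in>Basis. frechet_derivative l (at x) i *\<^sub>R blinfun_inner_left i)" for x
    using blinfun_basis_expansion[of "dl l x"] dl_apply[OF smooth_on_differentiable[OF l UNIV_I]] by simp
  then have "dl l = (\<lambda>x. \<Sum>i\<in>Basis. frechet_derivative l (at x) i *\<^sub>R blinfun_inner_left i)" by (rule ext)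
  moreover have "smooth_on UNIV (\<lambda>x. \<Sum>i\<in>Basis. frechet_derivative l (at x) i *\<^sub>R (blinfun_inner_left i :: 'e \<Rightarrow>\<^sub>L real))"
    by (rule smooth_on_sum[OF open_UNIV finite_Basis])
       (rule smooth_on_bounded_bilinear[OF open_UNIV bounded_bilinear_scaleR smooth_on_frechet_derivative[OF l] smooth_on_const])
  ultimately show ?thesis by simp
qed

lemma vector_derivative_delayed:
  "vector_derivative (\<lambda>s. \<phi> (s - \<tau>)) (at t) = vector_derivative \<phi> (at (t - \<tau>))"
proof -
  have "((\<lambda>s. \<phi> (s - \<tau>)) has_vector_derivative D) (at t) \<longleftrightarrow> (\<phi> has_vector_derivative D) (at (t - \<tau>))" for D
  proof
    assume "(\<phi> has_vector_derivative D) (at (t - \<tau>))"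
    then have d: "(\<phi> has_derivative (\<lambda>x. x *\<^sub>R D)) (at (t - \<tau>))" by (simp add: has_vector_derivative_def)
    have "((\<lambda>s. s - \<tau>) has_derivative (\<lambda>x. x)) (at t)" by (auto intro!: derivative_eq_intros)
    from has_derivative_compose[OF this d]
    show "((\<lambda>s. \<phi> (s - \<tau>)) has_vector_derivative D) (at t)" by (simp add: has_vector_derivative_def)
  next
    assume "((\<lambda>s. \<phi> (s - \<tau>)) has_vector_derivative D) (at t)"
    then have d: "((\<lambda>s. \<phi> (s - \<tau>)) has_derivative (\<lambda>x. x *\<^sub>R D)) (at ((t - \<tau>) + \<tau>))"
      by (simp add: has_vector_derivative_def)
    have "((\<lambda>s. s + \<tau>) has_derivative (\<lambda>x. x)) (at (t - \<tau>))" by (auto intro!: derivative_eq_intros)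
    from has_derivative_compose[OF this d]
    show "(\<phi> has_vector_derivative D) (at (t - \<tau>))" by (simp add: has_vector_derivative_def)
  qed
  then show ?thesis by (simp add: vector_derivative_def)
qed

lemma (in smooth_manifold) lift_delayed: "lift A (delayed \<tau> \<gamma>) t = lift A \<gamma> (t - \<tau>)"
proof -
  have "coord (chart_at A (\<gamma> (t - \<tau>))) \<circ> delayed \<tau> \<gamma>
      = (\<lambda>s. (coord (chart_at A (\<gamma> (t - \<tau>))) \<circ> \<gamma>) (s - \<tau>))"
    by (auto simp: delayed_def)
  then show ?thesis
    using vector_derivative_delayed[of "coord (chart_at A (\<gamma> (t - \<tau>))) \<circ> \<gamma>" \<tau> t]
    by (simp add: lift_def velocity_def) (simp add: delayed_def)
qed

context lie_group
begin

lemma bounded_bilinear_lie_bracket: "bounded_bilinear (lie_bracket A mul one)"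
proof -
  have "bilinear (lie_bracket A mul one)"
    unfolding bilinear_def lie_bracket_eq
    using linear_mul_hess by (auto intro!: linear_compose_sub)
  then show ?thesis by (simp add: bilinear_conv_bounded_bilinear)
qed

lemma ad_star_apply: "blinfun_apply (ad_star A mul one \<zeta> \<mu>) \<omega> = blinfun_apply \<mu> (lie_bracket A mul one \<zeta> \<omega>)"
proof -
  have "bounded_linear (\<lambda>\<omega>. blinfun_apply \<mu> (lie_bracket A mul one \<zeta> \<omega>))"
    by (rule bounded_linear_compose[OF blinfun.bounded_linear_right
          bounded_bilinear.bounded_linear_right[OF bounded_bilinear_lie_bracket]])
  then show ?thesis by (simp add: ad_star_def bounded_linear_Blinfun_apply)
qed

lemma from_unit_chart_one: "from_chart A unit_chart one = (\<lambda>v. v)"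
proof -
  have "((coord unit_chart \<circ> param unit_chart) has_derivative (\<lambda>v. v)) (at unit_coord)"
    by (rule has_derivative_transform_within_open[OF has_derivative_ident chart_img_open[OF unit_chart(1)] unit_chart(4)])
       (simp add: coord_param[OF unit_chart(1)])
  from frechet_derivative_at[OF this] show ?thesis
    by (simp add: from_chart_def coord_change_def unit_chart_def[symmetric] unit_coord_def[symmetric])
qed

lemma chart_tvec_one: "chart_tvec A unit_chart (unit_coord, v) = (one, v)"
  by (simp add: chart_tvec_def unit_chart from_unit_chart_one)

lemma smooth_lagrangian_at_one:
  assumes "smooth_lagrangian A L"
  shows "smooth_on UNIV (lagrangian_at_one one L)"
proof -
  have L: "smooth_on (chart_img unit_chart \<times> UNIV) (L \<circ> chart_tvec A unit_chart)"
    using assms unit_chart(1) by (simp add: smooth_lagrangian_def)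
  have "smooth_on UNIV (\<lambda>v. (L \<circ> chart_tvec A unit_chart) (unit_coord, v))"
    by (rule smooth_on_compose[OF open_UNIV _ _ L])
       (auto intro!: open_Times chart_img_open unit_chart
         smooth_on_Pair[OF open_UNIV smooth_on_const smooth_on_bounded_linear[OF bounded_linear_ident]])
  then show ?thesis by (simp add: chart_tvec_one lagrangian_at_one_def[abs_def])
qed

text \<open>At the identity the unit chart gives back the components used to represent tangent vectors, so the
coordinate expression of \<open>F\<close> there is \<open>f\<close> itself.\<close>

lemma continuous_force_at_one:
  assumes F: "smooth_force A F"
  shows "continuous_on UNIV (\<lambda>(x, y). force_at_one one F x y)"
proof -
  let ?G = "\<lambda>(z, z'). F (chart_tvec A unit_chart z) (chart_tvec A unit_chart z')
                    o\<^sub>L Blinfun (from_chart A unit_chart (param unit_chart (fst z)))"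
  have "continuous_on ((chart_img unit_chart \<times> UNIV) \<times> (chart_img unit_chart \<times> UNIV)) ?G"
    using F unit_chart(1) unfolding smooth_force_def by (intro smooth_on_imp_continuous_on) blast
  then have "continuous_on UNIV (\<lambda>p. ?G ((unit_coord, fst p), (unit_coord, snd p)))"
    by (rule continuous_on_compose2) (auto intro!: continuous_intros unit_chart)
  moreover have "Blinfun (\<lambda>v::'e. v) = id_blinfun"
    by (simp add: id_blinfun.abs_eq)
  moreover have "\<alpha> o\<^sub>L id_blinfun = \<alpha>" for \<alpha> :: "'e \<Rightarrow>\<^sub>L real"
    by (rule blinfun_eqI) simp
  ultimately show ?thesis
    by (simp add: chart_tvec_one unit_chart from_unit_chart_one force_at_one_def split_def)
qed

text \<open>Translating by the inverse of the foot point moves every tangent vector to the Lie algebra.\<close>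

lemma left_invariant_eq:
  assumes "left_invariant A mul L"
  shows "L (p, v) = lagrangian_at_one one L (tangent_map A (mul (ginv p)) p v)"
  using assms[unfolded left_invariant_def, rule_format, of "ginv p" "(p, v)"]
  by (simp add: left_act_def lagrangian_at_one_def)

text \<open>In the unit chart the displacement of \<open>H\<close> along the curve \<open>j\<close> is the straight line
\<open>unit_coord + s w\<close>, so its derivative is \<open>w\<close>. This produces maps with prescribed \<open>dlog\<close>.\<close>

lemma dlog_chart_curve:
  assumes W: "open W" "z \<in> W" and H: "smooth_map_on A W H"
    and j: "(j has_derivative (\<lambda>k. k *\<^sub>R v)) (at (0::real))" "j 0 = z"
    and eq: "\<And>s. s \<in> S \<Longrightarrow> H (j s) = mul (H z) (param unit_chart (unit_coord + s *\<^sub>R w))" and S: "open S" "0 \<in> S"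
  shows "dlog H z v = w"
proof -
  have "(\<lambda>s. unit_coord + s *\<^sub>R w) -` chart_img unit_chart = {s. unit_coord + s *\<^sub>R w \<in> chart_img unit_chart}" by auto
  moreover have "open ((\<lambda>s. unit_coord + s *\<^sub>R w) -` chart_img unit_chart)"
    by (intro open_vimage chart_img_open unit_chart continuous_intros)
  ultimately have U: "open (S \<inter> {s. unit_coord + s *\<^sub>R w \<in> chart_img unit_chart})" using S by auto
  have d: "((\<lambda>y. rel_coord H (z, y)) has_derivative dlog H z) (at (j 0))"
    using dlog_has_derivative(1)[OF W H] j(2) by simp
  have d1: "((\<lambda>s. rel_coord H (z, j s)) has_derivative (\<lambda>k. dlog H z (k *\<^sub>R v))) (at 0)"
    by (rule has_derivative_compose[OF j(1) d])
  have "((\<lambda>s. unit_coord + s *\<^sub>R w) has_derivative (\<lambda>k. k *\<^sub>R w)) (at 0)"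
    by (auto intro!: derivative_eq_intros)
  then have d2: "((\<lambda>s. rel_coord H (z, j s)) has_derivative (\<lambda>k. k *\<^sub>R w)) (at 0)"
  proof (rule has_derivative_transform_within_open[OF _ U])
    show "0 \<in> S \<inter> {s. unit_coord + s *\<^sub>R w \<in> chart_img unit_chart}" using S unit_chart by simp
    fix s assume s: "s \<in> S \<inter> {s. unit_coord + s *\<^sub>R w \<in> chart_img unit_chart}"
    then show "unit_coord + s *\<^sub>R w = rel_coord H (z, j s)"
      using eq[of s] coord_param[OF unit_chart(1)]
      by (simp add: rel_coord_def assoc[symmetric] group_left_neutral)
  qed
  from fun_cong[OF has_derivative_unique[OF d1 d2], of 1] show ?thesis by simp
qed

text \<open>The curve obtained by translating a coordinate line through the identity to \<open>param c x\<close> has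
logarithmic derivative \<open>w\<close>, and its coordinate velocity is the required \<open>v\<close>.\<close>

lemma surj_dlog_param:
  assumes c: "c \<in> A" "x \<in> chart_img c"
  obtains v where "dlog (param c) x v = w"
proof -
  define S where "S = {s::real. unit_coord + s *\<^sub>R w \<in> chart_img unit_chart}"
  have "open ((\<lambda>s. unit_coord + s *\<^sub>R w) -` chart_img unit_chart)"
    by (intro open_vimage chart_img_open unit_chart continuous_intros)
  moreover have "(\<lambda>s. unit_coord + s *\<^sub>R w) -` chart_img unit_chart = S" by (auto simp: S_def)
  ultimately have S: "open S" "0 \<in> S" using unit_chart by (simp_all add: S_def)
  \<comment> \<open>a coordinate line through the identity, translated to \<open>param c x\<close>\<close>
  define \<gamma> where "\<gamma> s = mul (param c x) (param unit_chart (unit_coord + s *\<^sub>R w))" for s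
  have "smooth_on S (\<lambda>s. unit_coord + s *\<^sub>R w)"
    by (rule smooth_on_add[OF S(1) smooth_on_const smooth_on_bounded_linear])
       (rule bounded_linear_scaleR_left)
  then have "smooth_map_on A S (\<lambda>s. param unit_chart (unit_coord + s *\<^sub>R w))"
    by (rule smooth_map_on_compose[OF S(1) chart_img_open[OF unit_chart(1)] smooth_map_on_param[OF unit_chart(1)]])
       (auto simp: S_def)
  then have \<gamma>: "smooth_map_on A S \<gamma>"
    unfolding \<gamma>_def by (intro smooth_map_on_mul S smooth_map_on_const)
  have \<gamma>0: "\<gamma> 0 = param c x" by (simp add: \<gamma>_def unit_chart)
  have "((\<lambda>s. s) has_derivative (\<lambda>k. k *\<^sub>R 1)) (at (0::real))" by (auto intro!: derivative_eq_intros)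
  then have "dlog \<gamma> 0 1 = w"
    by (rule dlog_chart_curve[where j="\<lambda>s. s" and H=\<gamma>, OF S \<gamma> _ refl _ S]) (simp add: \<gamma>0, simp add: \<gamma>_def)
  moreover have "dlog \<gamma> 0 1 = dlog (param c) x (frechet_derivative (coord c \<circ> \<gamma>) (at 0) 1)"
    using dlog_chain_param[OF S \<gamma> c(1)] by (simp add: \<gamma>0 param_in_chart_dom[OF c] coord_param[OF c])
  ultimately show ?thesis using that by simp
qed

end

section \<open>The residual and the Euler--Lagrange equations\<close>

text \<open>The data and hypotheses of the equivalence, gathered so that the four formulations can be compared
with the residual one at a time.\<close>

locale delayed_lie_group_system = lie_group A mul one ginv
  for A :: "('a::{t2_space,second_countable_topology}, 'e::euclidean_space) chart set"
    and mul one ginv +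
  fixes L :: "'a \<times> 'e \<Rightarrow> real" and F :: "('a, 'e) force"
    and \<tau> a b :: real and J :: "real set" and g :: "real \<Rightarrow> 'a"
  assumes L_smooth: "smooth_lagrangian A L" and L_inv: "left_invariant A mul L"
    and F_smooth: "smooth_force A F" and F_equiv: "equivariant_force A mul F"
    and delay: "\<tau> \<ge> 0" and ab: "a < b"
    and J: "open J" "{a - \<tau>..b} \<subseteq> J"
    and g_smooth: "smooth_map_on A J g"
begin

abbreviation "l \<equiv> lagrangian_at_one one L"
abbreviation "f \<equiv> force_at_one one F"
abbreviation "\<xi> \<equiv> body_velocity A mul ginv g"
abbreviation "bracket \<equiv> lie_bracket A mul one"

definition momentum :: "real \<Rightarrow> 'e \<Rightarrow>\<^sub>L real" where "momentum t = dl l (\<xi> t)"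

text \<open>The defect in the Euler--Poincare equations. The force occurs with a positive sign because it stands
on the right-hand side of the equations of motion.\<close>

definition residual :: "real \<Rightarrow> 'e \<Rightarrow>\<^sub>L real" where
  "residual t = ad_star A mul one (\<xi> t) (momentum t) + f (\<xi> t) (delayed \<tau> \<xi> t)
     - vector_derivative momentum (at t)"

lemma in_J: "t \<in> {a..b} \<Longrightarrow> t \<in> J" "t \<in> {a..b} \<Longrightarrow> t - \<tau> \<in> J"
  using J delay by auto

lemma l_smooth: "smooth_on UNIV l"
  by (rule smooth_lagrangian_at_one[OF L_smooth])

lemma l_has_derivative: "(l has_derivative blinfun_apply (dl l x)) (at x)"
proof -
  have "blinfun_apply (dl l x) = frechet_derivative l (at x)"
    by (rule ext) (rule dl_apply[OF smooth_on_differentiable[OF l_smooth UNIV_I]])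
  then show ?thesis using smooth_on_has_derivative[OF l_smooth UNIV_I] by simp
qed

lemma \<xi>_dlog: "t \<in> J \<Longrightarrow> \<xi> t = dlog g t 1"
  by (rule body_velocity_dlog[OF J(1) _ g_smooth])

lemma \<xi>_smooth: "smooth_on J \<xi>"
  using smooth_on_cong[OF J(1) \<xi>_dlog] dlog_smooth[OF J(1) g_smooth] by simp

lemma momentum_smooth: "smooth_on J momentum"
  unfolding momentum_def[abs_def]
  by (rule smooth_on_compose[OF J(1) open_UNIV _ smooth_on_dl[OF l_smooth] \<xi>_smooth]) simp

text \<open>Equivariance under independent translations of the current and the delayed argument moves both to the
identity, leaving a force that depends on the body velocities only.\<close>

lemma force_along_curve:
  "blinfun_apply (F (lift A g t) (lift A (delayed \<tau> g) t)) w
    = blinfun_apply (f (\<xi> t) (delayed \<tau> \<xi> t)) (tangent_map A (mul (ginv (g t))) (g t) w)"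
  using F_equiv unfolding equivariant_force_iff lift_delayed
  by (simp add: lift_def body_velocity_def delayed_def)

lemma euler_poincare_iff_residual:
  "euler_poincare_delay A mul one l f \<tau> a b \<xi> \<longleftrightarrow> (\<forall>t\<in>{a..b}. residual t = 0)"
proof -
  have "((\<lambda>s. dl l (\<xi> s)) has_vector_derivative
           ad_star A mul one (\<xi> t) (dl l (\<xi> t)) + f (\<xi> t) (delayed \<tau> \<xi> t)) (at t) \<longleftrightarrow> residual t = 0"
    if "t \<in> {a..b}" for t
    using smooth_on_differentiable[OF momentum_smooth in_J(1)[OF that]]
    unfolding momentum_def[symmetric] has_vector_derivative_iff_vector_derivative residual_def
    by auto
  then show ?thesis unfolding euler_poincare_delay_def by simp
qed

text \<open>The Lagrangian in coordinates is the reduced Lagrangian composed with the Maurer--Cartan form of the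
chart; its position dependence is that of the form alone.\<close>

lemma lagrangian_in_chart:
  assumes "c \<in> A" "x \<in> chart_img c"
  shows "(L \<circ> chart_tvec A c) (x, v) = l (dlog (param c) x v)"
  using left_invariant_eq[OF L_inv] tangent_map_from_chart_eq_dlog[OF assms]
  by (simp add: chart_tvec_def)

text \<open>With \<open>\<Phi>(x) = dlog (param c) x\<close> the Lagrangian is \<open>l (\<Phi>(x) v)\<close>. Its fibre derivative along the curve is
\<open>\<mu> (\<Phi>(q) i)\<close>, with time derivative \<open>\<mu>' (\<Phi>(q) i) + \<mu> (D\<Phi>[q'] i)\<close>, and its position derivative is
\<open>\<mu> (D\<Phi>[i] q')\<close>. By the Maurer--Cartan equation the difference \<open>D\<Phi>[q'] i - D\<Phi>[i] q'\<close> is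
\<open>- [\<xi>, \<Phi>(q) i]\<close>, which produces the coadjoint term.\<close>

lemma euler_lagrange_component:
  assumes t: "t \<in> {a..b}" and c: "c \<in> A" "g t \<in> chart_dom c"
  defines "Lc \<equiv> L \<circ> chart_tvec A c" and "q \<equiv> coord c \<circ> g"
  defines "q' \<equiv> \<lambda>s. vector_derivative q (at s)"
  shows "((\<lambda>s. frechet_derivative (\<lambda>v. Lc (q s, v)) (at (q' s)) i)
               has_real_derivative
                 frechet_derivative (\<lambda>x. Lc (x, q' t)) (at (q t)) i
                 + blinfun_apply (F (lift A g t) (lift A (delayed \<tau> g) t)) (from_chart A c (g t) i))
             (at t) \<longleftrightarrow> blinfun_apply (residual t) (dlog (param c) (q t) i) = 0"
proof -
  let ?W = "J \<inter> g -` chart_dom c" and ?P = "dlog (param c)" and ?X = "chart_img c"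
  note X = chart_img_open[OF c(1)] and P = smooth_map_on_param[OF c(1)]
  have W: "open ?W" by (rule open_chart_preimage[OF J(1) g_smooth c(1)])
  have tW: "t \<in> ?W" using in_J(1)[OF t] c(2) by simp
  have q: "smooth_on ?W q" unfolding q_def by (rule smooth_map_on_coord[OF g_smooth c(1)])
  have qX: "q s \<in> ?X" if "s \<in> ?W" for s using that by (simp add: q_def coord_in_chart_img)
  have \<xi>q: "\<xi> s = ?P (q s) (q' s)" if s: "s \<in> ?W" for s
  proof -
    have "frechet_derivative q (at s) 1 = q' s"
      by (simp add: q'_def frechet_derivative_eq_vector_derivative[OF smooth_on_differentiable[OF q s]])
    then show ?thesis
      using \<xi>_dlog[of s] dlog_chain_param[OF J(1) _ g_smooth c(1), of s 1] s by (simp add: q_def)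
  qed
  have fibre: "frechet_derivative (\<lambda>v. Lc (q s, v)) (at (q' s)) i = blinfun_apply (momentum s) (?P (q s) i)"
    if s: "s \<in> ?W" for s
  proof -
    have "bounded_linear (?P (q s))"
      using linear_dlog[OF X qX[OF s] P] by (simp add: linear_conv_bounded_linear)
    then have "(?P (q s) has_derivative ?P (q s)) (at (q' s))" by (rule bounded_linear_imp_has_derivative)
    from has_derivative_compose[OF this l_has_derivative]
    have "((\<lambda>v. Lc (q s, v)) has_derivative (\<lambda>v. blinfun_apply (momentum s) (?P (q s) v))) (at (q' s))"
      unfolding Lc_def by (simp only: lagrangian_in_chart[OF c(1) qX[OF s]] momentum_def \<xi>q[OF s])
    from fun_cong[OF frechet_derivative_at[OF this], of i] show ?thesis by simp
  qed
  define dP where "dP u v = frechet_derivative (\<lambda>x. ?P x v) (at (q t)) u" for u v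
  have dP: "((\<lambda>x. ?P x v) has_derivative (\<lambda>u. dP u v)) (at (q t))" for v
    unfolding dP_def by (rule smooth_on_has_derivative[OF dlog_smooth[OF X P] qX[OF tW]])
  have "((\<lambda>s. blinfun_apply (momentum s) (?P (q s) i)) has_vector_derivative
      blinfun_apply (momentum t) (dP (q' t) i) + blinfun_apply (vector_derivative momentum (at t)) (?P (q t) i)) (at t)"
  proof (rule bounded_bilinear.has_vector_derivative[OF bounded_bilinear_blinfun_apply])
    show "(momentum has_vector_derivative vector_derivative momentum (at t)) (at t)"
      using tW by (intro smooth_on_has_vector_derivative[OF momentum_smooth]) simp
    have "(q has_vector_derivative q' t) (at t)"
      unfolding q'_def by (rule smooth_on_has_vector_derivative[OF q tW])
    from vector_derivative_diff_chain_within[OF this has_derivative_at_withinI[OF dP]]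
    show "((\<lambda>s. ?P (q s) i) has_vector_derivative dP (q' t) i) (at t)" by (simp add: o_def)
  qed
  then have "((\<lambda>s. frechet_derivative (\<lambda>v. Lc (q s, v)) (at (q' s)) i) has_vector_derivative
      blinfun_apply (momentum t) (dP (q' t) i) + blinfun_apply (vector_derivative momentum (at t)) (?P (q t) i)) (at t)"
    by (rule has_vector_derivative_transform_within_open[OF _ W tW fibre[symmetric]])
  then have time: "((\<lambda>s. frechet_derivative (\<lambda>v. Lc (q s, v)) (at (q' s)) i) has_real_derivative
      blinfun_apply (momentum t) (dP (q' t) i) + blinfun_apply (vector_derivative momentum (at t)) (?P (q t) i)) (at t)"
    by (simp add: has_real_derivative_iff_has_vector_derivative)
  have space: "frechet_derivative (\<lambda>x. Lc (x, q' t)) (at (q t)) i = blinfun_apply (momentum t) (dP i (q' t))"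
  proof -
    have "((\<lambda>x. l (?P x (q' t))) has_derivative (\<lambda>u. blinfun_apply (momentum t) (dP u (q' t)))) (at (q t))"
      using has_derivative_compose[OF dP l_has_derivative, of "q' t"] by (simp only: momentum_def \<xi>q[OF tW])
    then have "((\<lambda>x. Lc (x, q' t)) has_derivative (\<lambda>u. blinfun_apply (momentum t) (dP u (q' t)))) (at (q t))"
      by (rule has_derivative_transform_within_open[OF _ X qX[OF tW]])
         (simp add: Lc_def lagrangian_in_chart[OF c(1), symmetric] del: comp_apply)
    from fun_cong[OF frechet_derivative_at[OF this], of i] show ?thesis by simp
  qed
  have force: "blinfun_apply (F (lift A g t) (lift A (delayed \<tau> g) t)) (from_chart A c (g t) i)
      = blinfun_apply (f (\<xi> t) (delayed \<tau> \<xi> t)) (?P (q t) i)"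
    using tangent_map_from_chart_eq_dlog[OF c(1) qX[OF tW]] param_coord[OF c]
    by (simp add: force_along_curve q_def)
  have "dP (q' t) i - dP i (q' t) = - bracket (\<xi> t) (?P (q t) i)"
    unfolding dP_def \<xi>q[OF tW] by (rule maurer_cartan[OF X qX[OF tW] P])
  then have "dP (q' t) i = dP i (q' t) - bracket (\<xi> t) (?P (q t) i)" by (simp add: algebra_simps)
  then have mc: "blinfun_apply (momentum t) (dP (q' t) i)
      = blinfun_apply (momentum t) (dP i (q' t)) - blinfun_apply (momentum t) (bracket (\<xi> t) (?P (q t) i))"
    by (simp add: blinfun.diff_right)
  have "((\<lambda>s. frechet_derivative (\<lambda>v. Lc (q s, v)) (at (q' s)) i) has_real_derivative D) (at t) \<longleftrightarrow>
     D = blinfun_apply (momentum t) (dP (q' t) i) + blinfun_apply (vector_derivative momentum (at t)) (?P (q t) i)"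
    for D using time DERIV_unique by blast
  then show ?thesis
    unfolding space force mc residual_def by (auto simp: blinfun.bilinear_simps ad_star_apply)
qed

lemma euler_lagrange_iff_residual:
  "euler_lagrange_delay A L F \<tau> a b g \<longleftrightarrow> (\<forall>t\<in>{a..b}. residual t = 0)"
proof
  assume EL: "euler_lagrange_delay A L F \<tau> a b g"
  show "\<forall>t\<in>{a..b}. residual t = 0"
  proof
    fix t assume t: "t \<in> {a..b}"
    let ?c = "chart_at A (g t)"
    let ?x = "coord ?c (g t)"
    have x: "?x \<in> chart_img ?c" by (rule coord_in_chart_img[OF chart_at(2)])
    have 0: "blinfun_apply (residual t) (dlog (param ?c) ?x i) = 0" if "i \<in> Basis" for i
      using EL[unfolded euler_lagrange_delay_def Let_def, rule_format, OF t chart_at(1) chart_at(2) that]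
        euler_lagrange_component[OF t chart_at] by simp
    have lin: "linear (\<lambda>v. blinfun_apply (residual t) (dlog (param ?c) ?x v))"
      using linear_compose[OF linear_dlog[OF chart_img_open[OF chart_at(1)] x smooth_map_on_param[OF chart_at(1)]]
          bounded_linear.linear[OF blinfun.bounded_linear_right]] by (simp add: o_def)
    have "blinfun_apply (residual t) w = 0" for w
    proof -
      obtain v where v: "dlog (param ?c) ?x v = w" by (rule surj_dlog_param[OF chart_at(1) x])
      show ?thesis using linear_eq_sum_Basis[OF lin, of v] 0 by (simp add: v)
    qed
    then show "residual t = 0" by (intro blinfun_eqI) simp
  qed
next
  assume "\<forall>t\<in>{a..b}. residual t = 0"
  then show "euler_lagrange_delay A L F \<tau> a b g"
    unfolding euler_lagrange_delay_def Let_def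
    by (intro ballI impI) (subst euler_lagrange_component, simp_all)
qed

end

section \<open>Tools from the calculus of variations\<close>

lemma real_polynomial_function_smooth:
  fixes p :: "real \<Rightarrow> real"
  assumes "real_polynomial_function p"
  shows "smooth_on UNIV p"
  using assms
proof (induction rule: real_polynomial_function.induct)
  case (linear f)
  then show ?case by (rule smooth_on_bounded_linear)
next
  case (const c)
  then show ?case by simp
next
  case (add f g)
  then show ?case by (intro smooth_on_add[OF open_UNIV])
next
  case (mult f g)
  then show ?case by (intro smooth_on_bounded_bilinear[OF open_UNIV bounded_bilinear_mult])
qed

text \<open>Approximating \<open>h\<close> uniformly by polynomials \<open>p\<close> makes the integral of \<open>h (h - p)\<close> small, and this
integral equals that of \<open>h\<^sup>2\<close>. Polynomials serve as test functions here in place of smooth functions of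
compact support.\<close>

lemma polynomial_moments_zero_imp_zero:
  fixes h :: "real \<Rightarrow> real"
  assumes ab: "a < b" and h: "continuous_on {a..b} h"
    and moments: "\<And>p. real_polynomial_function p \<Longrightarrow> integral {a..b} (\<lambda>t. h t * p t) = 0"
    and t: "t \<in> {a..b}"
  shows "h t = 0"
proof -
  define K where "K = integral {a..b} (\<lambda>t. \<bar>h t\<bar>)"
  have int: "(\<lambda>t. \<bar>h t\<bar>) integrable_on {a..b}" "(\<lambda>t. h t * h t) integrable_on {a..b}"
    using h by (auto intro!: integrable_continuous_real continuous_intros)
  have K: "K \<ge> 0" unfolding K_def by (rule integral_nonneg[OF int(1)]) simp
  have le: "integral {a..b} (\<lambda>t. h t * h t) \<le> e * K" if e: "e > 0" for e
  proof -
    obtain p where p: "real_polynomial_function p" "\<And>x. x \<in> {a..b} \<Longrightarrow> \<bar>h x - p x\<bar> < e"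
      using Stone_Weierstrass_real_polynomial_function[OF compact_Icc h e] by blast
    have pc: "continuous_on {a..b} p"
      using smooth_on_imp_continuous_on[OF real_polynomial_function_smooth[OF p(1)]]
      by (rule continuous_on_subset) simp
    have "integral {a..b} (\<lambda>t. h t * h t) = integral {a..b} (\<lambda>t. h t * h t) - integral {a..b} (\<lambda>t. h t * p t)"
      by (simp add: moments[OF p(1)])
    also have "\<dots> = integral {a..b} (\<lambda>t. h t * h t - h t * p t)"
      using h pc by (intro integral_diff[symmetric]) (auto intro!: integrable_continuous_real continuous_intros)
    also have "\<dots> \<le> integral {a..b} (\<lambda>t. e * \<bar>h t\<bar>)"
    proof (rule integral_le)
      show "(\<lambda>t. h t * h t - h t * p t) integrable_on {a..b}" "(\<lambda>t. e * \<bar>h t\<bar>) integrable_on {a..b}"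
        using h pc by (auto intro!: integrable_continuous_real continuous_intros)
      fix x assume x: "x \<in> {a..b}"
      have "h x * h x - h x * p x \<le> \<bar>h x\<bar> * \<bar>h x - p x\<bar>"
        by (metis abs_ge_self abs_mult right_diff_distrib)
      also have "\<dots> \<le> \<bar>h x\<bar> * e" using p(2)[OF x] by (intro mult_left_mono) auto
      finally show "h x * h x - h x * p x \<le> e * \<bar>h x\<bar>" by (simp add: mult.commute)
    qed
    also have "\<dots> = e * K" by (simp add: K_def)
    finally show ?thesis .
  qed
  have "integral {a..b} (\<lambda>t. h t * h t) \<le> 0"
  proof (rule field_le_epsilon)
    fix e :: real assume "e > 0"
    then have "integral {a..b} (\<lambda>t. h t * h t) \<le> (e / (K + 1)) * K" using K by (intro le) simp
    also have "\<dots> \<le> e" using K \<open>e > 0\<close> by (simp add: field_simps)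
    finally show "integral {a..b} (\<lambda>t. h t * h t) \<le> 0 + e" by simp
  qed
  moreover have "integral {a..b} (\<lambda>t. h t * h t) \<ge> 0" by (rule integral_nonneg[OF int(2)]) simp
  ultimately have "integral {a..b} (\<lambda>t. h t * h t) = 0" by simp
  moreover have "continuous_on {a..b} (\<lambda>t. h t * h t)" using h by (intro continuous_intros)
  ultimately show ?thesis using integral_eq_0_iff[of a b "\<lambda>t. h t * h t"] ab t by simp
qed

text \<open>A variation agrees with the curve only on the closed interval, so two-sided derivatives are
controlled in its interior only; the endpoints do not affect the integral.\<close>

lemma integral_eq_on_interior:
  fixes \<phi> \<psi> :: "real \<Rightarrow> real"
  assumes "\<And>t. t \<in> {a<..<b} \<Longrightarrow> \<phi> t = \<psi> t"
  shows "integral {a..b} \<phi> = integral {a..b} \<psi>"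
  by (rule integral_spike[of "{a, b}"]) (use assms in \<open>auto simp: not_le le_less\<close>)

lemma derivative_of_integral_smooth:
  fixes \<phi> :: "real \<times> real \<Rightarrow> real"
  assumes r: "r > 0" and \<phi>: "smooth_on ({-r<..<r} \<times> {a-r<..<b+r}) \<phi>"
  shows "((\<lambda>\<epsilon>. integral {a..b} (\<lambda>t. \<phi> (\<epsilon>, t))) has_real_derivative
     integral {a..b} (\<lambda>t. frechet_derivative \<phi> (at (0, t)) (1, 0))) (at 0)"
proof -
  let ?U = "{-r<..<r}"
  have sub: "?U \<times> {a..b} \<subseteq> ?U \<times> {a-r<..<b+r}" using r by auto
  have "((\<lambda>\<epsilon>. integral (cbox a b) (\<lambda>t. \<phi> (\<epsilon>, t))) has_real_derivative
     integral (cbox a b) (\<lambda>t. frechet_derivative \<phi> (at (0, t)) (1, 0))) (at 0 within ?U)"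
  proof (rule leibniz_rule_field_derivative[where f="\<lambda>\<epsilon> t. \<phi> (\<epsilon>, t)"
        and fx="\<lambda>\<epsilon> t. frechet_derivative \<phi> (at (\<epsilon>, t)) (1, 0)"])
    fix \<epsilon> t assume \<epsilon>: "\<epsilon> \<in> ?U" and t: "t \<in> cbox a b"
    then have mem: "(\<epsilon>, t) \<in> ?U \<times> {a-r<..<b+r}" using r by auto
    have lin: "frechet_derivative \<phi> (at (\<epsilon>, t)) (k, 0) = k * frechet_derivative \<phi> (at (\<epsilon>, t)) (1, 0)" for k
      using linear_cmul[OF smooth_on_linear[OF \<phi> mem], of k "(1, 0)"] by simp
    have "((\<lambda>\<epsilon>. \<phi> (\<epsilon>, t)) has_derivative (\<lambda>k. frechet_derivative \<phi> (at (\<epsilon>, t)) (k, 0))) (at \<epsilon>)"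
      by (rule smooth_on_has_derivative_fst[OF \<phi> mem])
    moreover have "(\<lambda>k. frechet_derivative \<phi> (at (\<epsilon>, t)) (k, 0)) = (*) (frechet_derivative \<phi> (at (\<epsilon>, t)) (1, 0))"
      by (rule ext) (rule trans[OF lin mult.commute])
    ultimately have "((\<lambda>\<epsilon>. \<phi> (\<epsilon>, t)) has_real_derivative frechet_derivative \<phi> (at (\<epsilon>, t)) (1, 0)) (at \<epsilon>)"
      by (simp only: has_field_derivative_def)
    then show "((\<lambda>\<epsilon>. \<phi> (\<epsilon>, t)) has_real_derivative frechet_derivative \<phi> (at (\<epsilon>, t)) (1, 0)) (at \<epsilon> within ?U)"
      by (rule has_field_derivative_at_within)
  next
    fix \<epsilon> assume \<epsilon>: "\<epsilon> \<in> ?U"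
    have "continuous_on {a..b} (\<lambda>t. \<phi> (\<epsilon>, t))"
      by (rule continuous_on_compose2[OF smooth_on_imp_continuous_on[OF \<phi>]])
         (use \<epsilon> r in \<open>auto intro!: continuous_intros\<close>)
    then show "(\<lambda>t. \<phi> (\<epsilon>, t)) integrable_on cbox a b" by (simp add: integrable_continuous_real)
  next
    have "continuous_on (?U \<times> {a..b}) (\<lambda>z. frechet_derivative \<phi> (at z) (1, 0))"
      by (rule continuous_on_subset[OF smooth_on_imp_continuous_on[OF smooth_on_frechet_derivative[OF \<phi>]] sub])
    then show "continuous_on (?U \<times> cbox a b) (\<lambda>(\<epsilon>, t). frechet_derivative \<phi> (at (\<epsilon>, t)) (1, 0))"
      by (simp add: split_def)
  qed (use r in auto)
  moreover have "at 0 within ?U = at (0::real)" by (rule at_within_open) (use r in auto)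
  ultimately show ?thesis by (simp only: cbox_interval)
qed

section \<open>The variational principles\<close>

context delayed_lie_group_system
begin

definition admissible :: "(real \<Rightarrow> 'e) \<Rightarrow> bool" where
  "admissible \<eta> \<longleftrightarrow> (\<exists>r>0. smooth_on {a-r<..<b+r} \<eta>) \<and> \<eta> a = 0 \<and> \<eta> b = 0"

text \<open>The equation that both variational principles impose on the infinitesimal variation \<open>\<eta>\<close>.\<close>

definition weak_balance :: "(real \<Rightarrow> 'e) \<Rightarrow> bool" where
  "weak_balance \<eta> \<longleftrightarrow>
    integral {a..b} (\<lambda>t. blinfun_apply (momentum t) (vector_derivative \<eta> (at t) + bracket (\<xi> t) (\<eta> t)))
    = - integral {a..b} (\<lambda>t. blinfun_apply (f (\<xi> t) (delayed \<tau> \<xi> t)) (\<eta> t))"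

lemma residual_apply:
  "blinfun_apply (residual t) v = blinfun_apply (momentum t) (bracket (\<xi> t) v)
     + blinfun_apply (f (\<xi> t) (delayed \<tau> \<xi> t)) v - blinfun_apply (vector_derivative momentum (at t)) v"
  by (simp add: residual_def blinfun.bilinear_simps ad_star_apply)

lemma continuous_along_curve:
  "continuous_on {a..b} \<xi>" "continuous_on {a..b} momentum"
  "continuous_on {a..b} (\<lambda>t. vector_derivative momentum (at t))"
  "continuous_on {a..b} (\<lambda>t. f (\<xi> t) (delayed \<tau> \<xi> t))"
proof -
  have sub: "{a..b} \<subseteq> J" using in_J(1) by blast
  show \<xi>: "continuous_on {a..b} \<xi>" and "continuous_on {a..b} momentum"
    and "continuous_on {a..b} (\<lambda>t. vector_derivative momentum (at t))"
    by (rule continuous_on_subset[OF smooth_on_imp_continuous_on sub],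
        rule \<xi>_smooth momentum_smooth smooth_on_vector_derivative[OF J(1) momentum_smooth])+
  have "continuous_on {a..b} (\<lambda>t. \<xi> (t - \<tau>))"
    by (rule continuous_on_compose2[OF smooth_on_imp_continuous_on[OF \<xi>_smooth]])
       (intro continuous_intros, rule image_subsetI, rule in_J(2))
  then have "continuous_on {a..b} (\<lambda>t. (\<xi> t, delayed \<tau> \<xi> t))"
    using \<xi> by (auto simp: delayed_def intro!: continuous_on_Pair)
  from continuous_on_compose2[OF continuous_force_at_one[OF F_smooth] this]
  show "continuous_on {a..b} (\<lambda>t. f (\<xi> t) (delayed \<tau> \<xi> t))" by simp
qed

lemma continuous_residual:
  assumes "continuous_on {a..b} \<eta>"
  shows "continuous_on {a..b} (\<lambda>t. blinfun_apply (residual t) (\<eta> t))"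
  unfolding residual_apply
  by (intro continuous_on_add continuous_on_diff blinfun.continuous_on continuous_along_curve assms
      bounded_bilinear.continuous_on[OF bounded_bilinear_lie_bracket])

text \<open>Integration by parts moves the derivative from \<open>\<eta>\<close> to the momentum; the boundary terms vanish with
\<open>\<eta>\<close> at the endpoints.\<close>

lemma weak_balance_iff_residual:
  assumes \<eta>: "admissible \<eta>"
  shows "weak_balance \<eta> \<longleftrightarrow> integral {a..b} (\<lambda>t. blinfun_apply (residual t) (\<eta> t)) = 0"
proof -
  obtain r where r: "r > 0" "smooth_on {a-r<..<b+r} \<eta>" and ends: "\<eta> a = 0" "\<eta> b = 0"
    using \<eta> unfolding admissible_def by blast
  have sub: "{a..b} \<subseteq> {a-r<..<b+r}" using r by auto
  let ?\<eta>' = "\<lambda>t. vector_derivative \<eta> (at t)" and ?m' = "\<lambda>t. vector_derivative momentum (at t)"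
  let ?f = "\<lambda>t. f (\<xi> t) (delayed \<tau> \<xi> t)"
  have \<eta>c: "continuous_on {a..b} \<eta>" and \<eta>'c: "continuous_on {a..b} ?\<eta>'"
    by (rule continuous_on_subset[OF smooth_on_imp_continuous_on sub],
        rule r(2) smooth_on_vector_derivative[OF open_greaterThanLessThan r(2)])+
  have bc: "continuous_on {a..b} (\<lambda>t. bracket (\<xi> t) (\<eta> t))"
    by (rule bounded_bilinear.continuous_on[OF bounded_bilinear_lie_bracket continuous_along_curve(1) \<eta>c])
  note int = integrable_continuous_real[OF blinfun.continuous_on]
  note i1 = int[OF continuous_along_curve(2) \<eta>'c] and i2 = int[OF continuous_along_curve(2) bc]
    and i3 = int[OF continuous_along_curve(3) \<eta>c] and i4 = int[OF continuous_along_curve(4) \<eta>c]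
  have "((\<lambda>t. blinfun_apply (momentum t) (?\<eta>' t) + blinfun_apply (?m' t) (\<eta> t)) has_integral
      blinfun_apply (momentum b) (\<eta> b) - blinfun_apply (momentum a) (\<eta> a)) {a..b}"
  proof (rule fundamental_theorem_of_calculus)
    fix t assume t: "t \<in> {a..b}"
    show "((\<lambda>t. blinfun_apply (momentum t) (\<eta> t)) has_vector_derivative
        blinfun_apply (momentum t) (?\<eta>' t) + blinfun_apply (?m' t) (\<eta> t)) (at t within {a..b})"
      by (rule has_vector_derivative_at_within, rule bounded_bilinear.has_vector_derivative[OF
            bounded_bilinear_blinfun_apply smooth_on_has_vector_derivative[OF momentum_smooth in_J(1)[OF t]]
            smooth_on_has_vector_derivative[OF r(2) subsetD[OF sub t]]])
  qed (use ab in simp)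
  then have "integral {a..b} (\<lambda>t. blinfun_apply (momentum t) (?\<eta>' t) + blinfun_apply (?m' t) (\<eta> t)) = 0"
    by (simp add: ends integral_unique)
  then have parts: "integral {a..b} (\<lambda>t. blinfun_apply (momentum t) (?\<eta>' t))
      = - integral {a..b} (\<lambda>t. blinfun_apply (?m' t) (\<eta> t))"
    by (simp add: integral_add[OF i1 i3])
  show ?thesis
    unfolding weak_balance_def residual_apply blinfun.add_right
    by (simp add: integral_add i1 i2 i3 i4 integral_diff integrable_add parts) argo
qed

text \<open>The fundamental lemma of the calculus of variations. The test functions are polynomials times
\<open>(t - a) (b - t) v\<close>; the factor enforces the boundary condition and does not vanish in the
interior, and continuity takes care of the endpoints.\<close>

lemma residual_zero_iff_weak:
  "(\<forall>t\<in>{a..b}. residual t = 0) \<longleftrightarrow>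
    (\<forall>\<eta>. admissible \<eta> \<longrightarrow> integral {a..b} (\<lambda>t. blinfun_apply (residual t) (\<eta> t)) = 0)"
    (is "?L \<longleftrightarrow> ?R")
proof
  assume ?L
  then have "integral {a..b} (\<lambda>t. blinfun_apply (residual t) (\<eta> t)) = integral {a..b} (\<lambda>t. 0)" for \<eta> :: "real \<Rightarrow> 'e"
    by (intro integral_cong) simp
  then show ?R by simp
next
  assume R: ?R
  have zero: "blinfun_apply (residual t) v = 0" if t: "t \<in> {a..b}" for t v
  proof -
    let ?h = "\<lambda>t. ((t - a) * (b - t)) * blinfun_apply (residual t) v"
    have rc: "continuous_on {a..b} (\<lambda>t. blinfun_apply (residual t) v)"
      by (rule continuous_residual) simp
    have hz: "?h t = 0" if "t \<in> {a..b}" for t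
    proof (rule polynomial_moments_zero_imp_zero[OF ab _ _ that])
      show "continuous_on {a..b} ?h" by (intro continuous_intros rc)
      fix p :: "real \<Rightarrow> real" assume p: "real_polynomial_function p"
      let ?\<eta> = "\<lambda>t. ((t - a) * (b - t) * p t) *\<^sub>R v"
      have "real_polynomial_function (\<lambda>t. (t + - a) * (b + (-1) * t) * p t)"
        by (intro real_polynomial_function.intros p bounded_linear_ident)
      then have "smooth_on UNIV (\<lambda>t. (t - a) * (b - t) * p t)"
        using real_polynomial_function_smooth by simp
      then have "smooth_on UNIV ?\<eta>"
        by (rule smooth_on_bounded_linear_compose[OF open_UNIV bounded_linear_scaleR_left])
      then have "smooth_on {a-1<..<b+1} ?\<eta>" by (rule smooth_on_subset) simp
      then have "admissible ?\<eta>"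
        unfolding admissible_def by (intro conjI exI[of _ 1]) simp_all
      with R have "integral {a..b} (\<lambda>t. blinfun_apply (residual t) (?\<eta> t)) = 0" by blast
      then show "integral {a..b} (\<lambda>t. ?h t * p t) = 0"
        by (simp add: blinfun.scaleR_right mult_ac)
    qed
    have int: "blinfun_apply (residual t) v = 0" if "t \<in> {a<..<b}" for t
      using hz[of t] that by simp
    have "closure {a<..<b} = {a..b}" using ab by simp
    then show ?thesis
      using continuous_constant_on_closure[of "{a<..<b}" "\<lambda>t. blinfun_apply (residual t) v" 0 t] rc int t by simp
  qed
  show ?L by (intro ballI blinfun_eqI) (simp add: zero)
qed

text \<open>The first variation of the reduced action depends on \<open>\<Xi>\<close> only through its first order part
\<open>\<eta>' + [\<xi>, \<eta>]\<close>. This is the common core of the two variational principles.\<close>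

lemma action_variation:
  assumes r: "r > 0" and \<Xi>: "smooth_on ({-r<..<r} \<times> {a-r<..<b+r}) \<Xi>"
    and \<Xi>0: "\<And>t. t \<in> {a<..<b} \<Longrightarrow> \<Xi> (0, t) = \<xi> t"
    and \<delta>\<Xi>: "\<And>t. t \<in> {a<..<b} \<Longrightarrow>
        frechet_derivative \<Xi> (at (0, t)) (1, 0) = vector_derivative \<eta> (at t) + bracket (\<xi> t) (\<eta> t)"
  shows "((\<lambda>\<epsilon>. integral {a..b} (\<lambda>t. l (\<Xi> (\<epsilon>, t)))) has_real_derivative
      - integral {a..b} (\<lambda>t. blinfun_apply (f (\<xi> t) (delayed \<tau> \<xi> t)) (\<eta> t))) (at 0)
    \<longleftrightarrow> weak_balance \<eta>"
proof -
  let ?R = "{-r<..<r} \<times> {a-r<..<b+r}"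
  have R: "open ?R" by (intro open_Times) auto
  have sm: "smooth_on ?R (\<lambda>z. l (\<Xi> z))"
    by (rule smooth_on_compose[OF R open_UNIV _ l_smooth \<Xi>]) simp
  have "frechet_derivative (\<lambda>z. l (\<Xi> z)) (at (0, t)) (1, 0)
      = blinfun_apply (momentum t) (vector_derivative \<eta> (at t) + bracket (\<xi> t) (\<eta> t))"
    if t: "t \<in> {a<..<b}" for t
  proof -
    have mem: "(0, t) \<in> ?R" using t r by auto
    have "((\<lambda>z. l (\<Xi> z)) has_derivative
        (\<lambda>v. blinfun_apply (dl l (\<Xi> (0, t))) (frechet_derivative \<Xi> (at (0, t)) v))) (at (0, t))"
      by (rule has_derivative_compose[OF smooth_on_has_derivative[OF \<Xi> mem] l_has_derivative])
    from fun_cong[OF frechet_derivative_at[OF this], of "(1, 0)"] show ?thesis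
      by (simp add: \<Xi>0[OF t] \<delta>\<Xi>[OF t] momentum_def)
  qed
  then have "integral {a..b} (\<lambda>t. frechet_derivative (\<lambda>z. l (\<Xi> z)) (at (0, t)) (1, 0))
     = integral {a..b} (\<lambda>t. blinfun_apply (momentum t) (vector_derivative \<eta> (at t) + bracket (\<xi> t) (\<eta> t)))"
    by (rule integral_eq_on_interior)
  with derivative_of_integral_smooth[OF r sm]
  have d: "((\<lambda>\<epsilon>. integral {a..b} (\<lambda>t. l (\<Xi> (\<epsilon>, t)))) has_real_derivative
      integral {a..b} (\<lambda>t. blinfun_apply (momentum t) (vector_derivative \<eta> (at t) + bracket (\<xi> t) (\<eta> t)))) (at 0)"
    by simp
  show ?thesis unfolding weak_balance_def
  proof
    assume "((\<lambda>\<epsilon>. integral {a..b} (\<lambda>t. l (\<Xi> (\<epsilon>, t)))) has_real_derivative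
      - integral {a..b} (\<lambda>t. blinfun_apply (f (\<xi> t) (delayed \<tau> \<xi> t)) (\<eta> t))) (at 0)"
    then show "integral {a..b} (\<lambda>t. blinfun_apply (momentum t) (vector_derivative \<eta> (at t) + bracket (\<xi> t) (\<eta> t)))
      = - integral {a..b} (\<lambda>t. blinfun_apply (f (\<xi> t) (delayed \<tau> \<xi> t)) (\<eta> t))"
      by (rule DERIV_unique[OF d])
  qed (use d in \<open>simp only:\<close>)
qed

text \<open>Variations and test functions are required to be smooth slightly beyond \<open>[a, b]\<close>.\<close>

lemma J_collar: obtains r where "r > 0" "{a-r<..<b+r} \<subseteq> J"
proof -
  have "a \<in> J" "b \<in> J" using in_J(1) ab by auto
  obtain r1 where r1: "r1 > 0" "ball a r1 \<subseteq> J" by (rule openE[OF J(1) \<open>a \<in> J\<close>])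
  obtain r2 where r2: "r2 > 0" "ball b r2 \<subseteq> J" by (rule openE[OF J(1) \<open>b \<in> J\<close>])
  show ?thesis
  proof (rule that[of "min r1 r2"])
    show "{a - min r1 r2<..<b + min r1 r2} \<subseteq> J"
    proof
      fix t assume t: "t \<in> {a - min r1 r2<..<b + min r1 r2}"
      consider "t < a" | "t > b" | "t \<in> {a..b}" by fastforce
      then show "t \<in> J"
      proof cases
        case 1
        then have "t \<in> ball a r1" using t min.cobounded1[of r1 r2] by (auto simp: dist_real_def)
        then show ?thesis using r1(2) by blast
      next
        case 2
        then have "t \<in> ball b r2" using t min.cobounded2[of r1 r2] by (auto simp: dist_real_def)
        then show ?thesis using r2(2) by blast
      next
        case 3
        then show ?thesis by (rule in_J(1))
      qed
    qed
  qed (use r1 r2 in simp)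
qed

text \<open>Every admissible \<open>\<eta>\<close> belongs to a reduced variation, the affine one
\<open>\<xi> + \<epsilon> (\<eta>' + [\<xi>, \<eta>])\<close>.\<close>

lemma reduced_principle_iff_residual:
  "reduced_principle_delay A mul one l f \<tau> a b \<xi> \<longleftrightarrow> (\<forall>t\<in>{a..b}. residual t = 0)"
proof -
  have principle_iff: "((\<lambda>\<epsilon>. integral {a..b} (\<lambda>t. l (\<Xi> (\<epsilon>, t)))) has_real_derivative
      - integral {a..b} (\<lambda>t. blinfun_apply (f (\<xi> t) (delayed \<tau> \<xi> t)) (\<eta> t))) (at 0)
    \<longleftrightarrow> integral {a..b} (\<lambda>t. blinfun_apply (residual t) (\<eta> t)) = 0"
    if red: "reduced_variation A mul one a b \<xi> \<eta> \<Xi>" for \<eta> \<Xi>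
  proof -
    obtain r where r: "r > 0" and \<eta>: "smooth_on {a-r<..<b+r} \<eta>"
      and \<Xi>: "smooth_on ({-r<..<r} \<times> {a-r<..<b+r}) \<Xi>"
      using red unfolding reduced_variation_def by blast
    have adm: "admissible \<eta>" using red r \<eta> unfolding reduced_variation_def admissible_def by blast
    have "\<Xi> (0, t) = \<xi> t"
      "frechet_derivative \<Xi> (at (0, t)) (1, 0) = vector_derivative \<eta> (at t) + bracket (\<xi> t) (\<eta> t)"
      if t: "t \<in> {a<..<b}" for t
    proof -
      have mem: "(0, t) \<in> {-r<..<r} \<times> {a-r<..<b+r}" using t r by auto
      have d: "((\<lambda>\<epsilon>. \<Xi> (\<epsilon>, t)) has_derivative (\<lambda>v. frechet_derivative \<Xi> (at (0, t)) (v, 0))) (at 0)"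
        by (rule smooth_on_has_derivative_fst[OF \<Xi> mem])
      have "vector_derivative (\<lambda>\<epsilon>. \<Xi> (\<epsilon>, t)) (at 0) = frechet_derivative (\<lambda>\<epsilon>. \<Xi> (\<epsilon>, t)) (at 0) 1"
        using frechet_derivative_eq_vector_derivative[OF differentiableI[OF d]] by simp
      also have "\<dots> = frechet_derivative \<Xi> (at (0, t)) (1, 0)"
        by (rule fun_cong[OF frechet_derivative_at[OF d], symmetric])
      finally show "\<Xi> (0, t) = \<xi> t"
        "frechet_derivative \<Xi> (at (0, t)) (1, 0) = vector_derivative \<eta> (at t) + bracket (\<xi> t) (\<eta> t)"
        using red t unfolding reduced_variation_def by auto
    qed
    from action_variation[OF r \<Xi> this] show ?thesis
      by (simp only: weak_balance_iff_residual[OF adm])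
  qed
  have ex: "\<exists>\<Xi>. reduced_variation A mul one a b \<xi> \<eta> \<Xi>" if adm: "admissible \<eta>" for \<eta>
  proof -
    obtain r1 where r1: "r1 > 0" "smooth_on {a-r1<..<b+r1} \<eta>" using adm unfolding admissible_def by blast
    obtain r2 where r2: "r2 > 0" "{a-r2<..<b+r2} \<subseteq> J" by (rule J_collar)
    define r where "r = min r1 r2"
    have "r > 0" "r \<le> r1" "r \<le> r2" using r1 r2 by (simp_all add: r_def)
    then have r: "r > 0" "{a-r<..<b+r} \<subseteq> {a-r1<..<b+r1}" "{a-r<..<b+r} \<subseteq> {a-r2<..<b+r2}" by auto
    have rJ: "{a-r<..<b+r} \<subseteq> J" using r(3) r2(2) by (rule order_trans)
    let ?I = "{a-r<..<b+r}" and ?R = "{-r<..<r} \<times> {a-r<..<b+r}"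
    let ?\<delta> = "\<lambda>t. vector_derivative \<eta> (at t) + bracket (\<xi> t) (\<eta> t)"
    let ?\<Xi> = "\<lambda>z. \<xi> (snd z) + fst z *\<^sub>R ?\<delta> (snd z)"
    have R: "open ?R" by (intro open_Times) auto
    have \<eta>: "smooth_on ?I \<eta>" and \<xi>: "smooth_on ?I \<xi>"
      by (rule smooth_on_subset[OF r1(2) r(2)], rule smooth_on_subset[OF \<xi>_smooth rJ])
    have \<delta>: "smooth_on ?I ?\<delta>"
      by (intro smooth_on_add smooth_on_vector_derivative smooth_on_bounded_bilinear[OF _ bounded_bilinear_lie_bracket] \<eta> \<xi>) auto
    have snd: "smooth_on ?R (\<lambda>z. \<phi> (snd z))" if "smooth_on ?I \<phi>" for \<phi> :: "real \<Rightarrow> 'e"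
      by (rule smooth_on_compose[OF R _ _ that smooth_on_bounded_linear[OF bounded_linear_snd]]) auto
    have \<Xi>: "smooth_on ?R ?\<Xi>"
      by (rule smooth_on_add[OF R snd[OF \<xi>] smooth_on_bounded_bilinear[OF R bounded_bilinear_scaleR
              smooth_on_bounded_linear[OF bounded_linear_fst] snd[OF \<delta>]]])
    have "((\<lambda>\<epsilon>. ?\<Xi> (\<epsilon>, t)) has_vector_derivative ?\<delta> t) (at 0)" for t
      unfolding has_vector_derivative_def by (auto intro!: derivative_eq_intros)
    then have "vector_derivative (\<lambda>\<epsilon>. ?\<Xi> (\<epsilon>, t)) (at 0) = ?\<delta> t" for t
      by (rule vector_derivative_at)
    then have "reduced_variation A mul one a b \<xi> \<eta> ?\<Xi>"
      using adm r(1) \<eta> \<Xi> unfolding reduced_variation_def admissible_def by auto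
    then show ?thesis by blast
  qed
  have adm: "admissible \<eta>" if "reduced_variation A mul one a b \<xi> \<eta> \<Xi>" for \<eta> \<Xi>
    using that unfolding reduced_variation_def admissible_def by blast
  show ?thesis
    unfolding reduced_principle_delay_def residual_zero_iff_weak
    using principle_iff ex adm by blast
qed

text \<open>The logarithmic derivative of \<open>H\<close> in the \<open>t\<close>-direction is the body velocity of the varied curve, and
that in the \<open>\<epsilon>\<close>-direction is the left translate \<open>\<eta>\<close> of \<open>\<delta>g\<close>. The Maurer--Cartan equation relates
them by \<open>\<delta>\<xi> = \<eta>' + [\<xi>, \<eta>]\<close>, and the claim reduces to the first variation of the reduced action.\<close>

lemma lagrange_dalembert_for_variation:
  assumes var: "fixed_end_variation A a b g H"
  defines "\<eta> \<equiv> \<lambda>t. dlog H (0, t) (1, 0)"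
  shows "((\<lambda>\<epsilon>. integral {a..b} (\<lambda>t. L (lift A (\<lambda>s. H (\<epsilon>, s)) t)))
          has_real_derivative
            - integral {a..b} (\<lambda>t. blinfun_apply (F (lift A g t) (lift A (delayed \<tau> g) t))
                                     (velocity A (\<lambda>\<epsilon>. H (\<epsilon>, t)) 0))) (at 0)
      \<longleftrightarrow> integral {a..b} (\<lambda>t. blinfun_apply (residual t) (\<eta> t)) = 0"
    and "admissible \<eta>"
proof -
  obtain r where r: "r > 0" and H: "smooth_map_on A ({-r<..<r} \<times> {a-r<..<b+r}) H"
    and H0: "\<And>t. t \<in> {a..b} \<Longrightarrow> H (0, t) = g t"
    and Hab: "\<And>\<epsilon>. \<epsilon> \<in> {-r<..<r} \<Longrightarrow> H (\<epsilon>, a) = g a \<and> H (\<epsilon>, b) = g b"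
    using var unfolding fixed_end_variation_def by blast
  let ?E = "{-r<..<r}" and ?I = "{a-r<..<b+r}"
  let ?R = "?E \<times> ?I"
  have R: "open ?R" by (intro open_Times) auto
  have time: "body_velocity A mul ginv (\<lambda>s. H (\<epsilon>, s)) t = dlog H (\<epsilon>, t) (0, 1)"
    "dlog (\<lambda>s. H (\<epsilon>, s)) t 1 = dlog H (\<epsilon>, t) (0, 1)"
    "smooth_map_on A ?I (\<lambda>s. H (\<epsilon>, s))" if z: "(\<epsilon>, t) \<in> ?R" for \<epsilon> t
  proof -
    have sm: "smooth_on ?I (\<lambda>s. (\<epsilon>, s))"
      by (intro smooth_on_Pair smooth_on_const smooth_on_bounded_linear bounded_linear_ident) auto
    show sl: "smooth_map_on A ?I (\<lambda>s. H (\<epsilon>, s))"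
      by (rule smooth_map_on_compose[OF open_greaterThanLessThan R H sm]) (use z in auto)
    have "((\<lambda>s. (\<epsilon>, s)) has_derivative (\<lambda>v. (0, v))) (at t)" by (auto intro!: derivative_eq_intros)
    then show dl: "dlog (\<lambda>s. H (\<epsilon>, s)) t 1 = dlog H (\<epsilon>, t) (0, 1)"
      by (rule dlog_compose[where j="\<lambda>s. (\<epsilon>, s)", OF R z H])
    show "body_velocity A mul ginv (\<lambda>s. H (\<epsilon>, s)) t = dlog H (\<epsilon>, t) (0, 1)"
      unfolding dl[symmetric] by (rule body_velocity_dlog[OF open_greaterThanLessThan _ sl]) (use z in auto)
  qed
  have par: "body_velocity A mul ginv (\<lambda>\<epsilon>. H (\<epsilon>, t)) 0 = \<eta> t"
    "dlog (\<lambda>\<epsilon>. H (\<epsilon>, t)) 0 1 = \<eta> t" "smooth_map_on A ?E (\<lambda>\<epsilon>. H (\<epsilon>, t))" if t: "t \<in> ?I" for t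
  proof -
    have sm: "smooth_on ?E (\<lambda>\<epsilon>. (\<epsilon>, t))"
      by (intro smooth_on_Pair smooth_on_const smooth_on_bounded_linear bounded_linear_ident) auto
    show sl: "smooth_map_on A ?E (\<lambda>\<epsilon>. H (\<epsilon>, t))"
      by (rule smooth_map_on_compose[OF open_greaterThanLessThan R H sm]) (use t in auto)
    have z: "(0, t) \<in> ?R" using t r by simp
    have "((\<lambda>\<epsilon>. (\<epsilon>, t)) has_derivative (\<lambda>v. (v, 0))) (at 0)" by (auto intro!: derivative_eq_intros)
    then show dl: "dlog (\<lambda>\<epsilon>. H (\<epsilon>, t)) 0 1 = \<eta> t"
      unfolding \<eta>_def by (rule dlog_compose[where j="\<lambda>\<epsilon>. (\<epsilon>, t)", OF R z H])
    show "body_velocity A mul ginv (\<lambda>\<epsilon>. H (\<epsilon>, t)) 0 = \<eta> t"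
      unfolding dl[symmetric] by (rule body_velocity_dlog[OF open_greaterThanLessThan _ sl]) (use r in auto)
  qed
  have \<eta>_smooth: "smooth_on ?I \<eta>"
    unfolding \<eta>_def
    by (rule smooth_on_compose[where f="\<lambda>t. (0, t)", OF _ R _ dlog_smooth[OF R H]])
       (use r in \<open>auto intro!: smooth_on_Pair smooth_on_bounded_linear[OF bounded_linear_ident]\<close>)
  have "\<eta> t = 0" if "t = a \<or> t = b" for t
  proof -
    have t: "t \<in> ?I" using that r ab by auto
    have "dlog (\<lambda>\<epsilon>. H (\<epsilon>, t)) 0 1 = dlog (\<lambda>\<epsilon>::real. g t) 0 1"
      by (rule dlog_cong[OF _ _ par(3)[OF t], where U="?E"]) (use r Hab that in auto)
    then show ?thesis by (simp add: par(2)[OF t] dlog_const)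
  qed
  then show adm: "admissible \<eta>"
    unfolding admissible_def using r \<eta>_smooth by blast
  let ?\<Xi> = "\<lambda>z. dlog H z (0, 1)"
  have \<Xi>: "smooth_on ?R ?\<Xi>" by (rule dlog_smooth[OF R H])
  have \<Xi>0: "?\<Xi> (0, t) = \<xi> t" if t: "t \<in> {a<..<b}" for t
  proof -
    have z: "(0, t) \<in> ?R" using t r by auto
    have "dlog (\<lambda>s. H (0, s)) t 1 = dlog g t 1"
      by (rule dlog_cong[OF _ _ time(3)[OF z], where U="{a<..<b}"]) (use t r H0 in auto)
    then show ?thesis using time(2)[OF z] \<xi>_dlog[OF in_J(1), of t] t by simp
  qed
  have \<delta>\<Xi>: "frechet_derivative ?\<Xi> (at (0, t)) (1, 0) = vector_derivative \<eta> (at t) + bracket (\<xi> t) (\<eta> t)"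
    if t: "t \<in> {a<..<b}" for t
  proof -
    have z: "(0, t) \<in> ?R" using t r by auto
    have d: "(\<eta> has_derivative (\<lambda>v. frechet_derivative (\<lambda>z. dlog H z (1, 0)) (at (0, t)) (0, v))) (at t)"
      unfolding \<eta>_def by (rule smooth_on_has_derivative_snd[OF dlog_smooth[OF R H] z])
    have "vector_derivative \<eta> (at t) = frechet_derivative \<eta> (at t) 1"
      using frechet_derivative_eq_vector_derivative[OF differentiableI[OF d]] by simp
    also have "\<dots> = frechet_derivative (\<lambda>z. dlog H z (1, 0)) (at (0, t)) (0, 1)"
      by (rule fun_cong[OF frechet_derivative_at[OF d], symmetric])
    finally have "frechet_derivative ?\<Xi> (at (0, t)) (1, 0) - vector_derivative \<eta> (at t) = - bracket (\<eta> t) (\<xi> t)"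
      using maurer_cartan[OF R z H, of "(0, 1)" "(1, 0)"] \<Xi>0[OF t] by (simp add: \<eta>_def)
    then show ?thesis by (simp add: lie_bracket_eq algebra_simps)
  qed
  have lag: "((\<lambda>\<epsilon>. integral {a..b} (\<lambda>t. L (lift A (\<lambda>s. H (\<epsilon>, s)) t))) has_real_derivative D) (at 0)
      \<longleftrightarrow> ((\<lambda>\<epsilon>. integral {a..b} (\<lambda>t. l (?\<Xi> (\<epsilon>, t)))) has_real_derivative D) (at 0)" for D
  proof (rule DERIV_cong_ev[OF refl _ refl])
    have ev: "\<forall>\<^sub>F \<epsilon> in nhds 0. \<epsilon> \<in> ?E" using r by (intro eventually_nhds_in_open) auto
    have "integral {a..b} (\<lambda>t. L (lift A (\<lambda>s. H (\<epsilon>, s)) t)) = integral {a..b} (\<lambda>t. l (?\<Xi> (\<epsilon>, t)))"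
      if "\<epsilon> \<in> ?E" for \<epsilon>
    proof (rule integral_cong)
      fix t assume "t \<in> {a..b}"
      then have "(\<epsilon>, t) \<in> ?R" using that r by auto
      from time(1)[OF this] show "L (lift A (\<lambda>s. H (\<epsilon>, s)) t) = l (?\<Xi> (\<epsilon>, t))"
        by (simp add: lift_def left_invariant_eq[OF L_inv] body_velocity_def)
    qed
    from eventually_mono[OF ev this]
    show "\<forall>\<^sub>F \<epsilon> in nhds 0. integral {a..b} (\<lambda>t. L (lift A (\<lambda>s. H (\<epsilon>, s)) t))
        = integral {a..b} (\<lambda>t. l (?\<Xi> (\<epsilon>, t)))" .
  qed
  have force: "integral {a..b} (\<lambda>t. blinfun_apply (F (lift A g t) (lift A (delayed \<tau> g) t))
                                     (velocity A (\<lambda>\<epsilon>. H (\<epsilon>, t)) 0))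
      = integral {a..b} (\<lambda>t. blinfun_apply (f (\<xi> t) (delayed \<tau> \<xi> t)) (\<eta> t))"
  proof (rule integral_cong)
    fix t assume t: "t \<in> {a..b}"
    then have "t \<in> ?I" using r by auto
    from par(1)[OF this] H0[OF t]
    show "blinfun_apply (F (lift A g t) (lift A (delayed \<tau> g) t)) (velocity A (\<lambda>\<epsilon>. H (\<epsilon>, t)) 0)
      = blinfun_apply (f (\<xi> t) (delayed \<tau> \<xi> t)) (\<eta> t)"
      by (simp add: force_along_curve body_velocity_def[of _ _ _ "\<lambda>\<epsilon>. H (\<epsilon>, t)"])
  qed
  show "((\<lambda>\<epsilon>. integral {a..b} (\<lambda>t. L (lift A (\<lambda>s. H (\<epsilon>, s)) t)))
          has_real_derivative
            - integral {a..b} (\<lambda>t. blinfun_apply (F (lift A g t) (lift A (delayed \<tau> g) t))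
                                     (velocity A (\<lambda>\<epsilon>. H (\<epsilon>, t)) 0))) (at 0)
      \<longleftrightarrow> integral {a..b} (\<lambda>t. blinfun_apply (residual t) (\<eta> t)) = 0"
    unfolding lag force
    using action_variation[where \<Xi>="?\<Xi>" and \<eta>=\<eta>, OF r \<Xi> \<Xi>0 \<delta>\<Xi>] weak_balance_iff_residual[OF adm]
    by (simp only:)
qed

text \<open>Take \<open>H(\<epsilon>, t) = g(t) k(\<epsilon> \<eta>(t))\<close> with \<open>k(w) = param unit_chart (unit_coord + w)\<close>, a chart-based
substitute for the exponential map. The variation is defined only while \<open>\<epsilon> \<eta>(t)\<close> stays in the chart,
which a bound on \<open>\<eta>\<close> over a compact interval guarantees for small \<open>\<epsilon>\<close>.\<close>

lemma variation_exists:
  assumes adm: "admissible \<eta>"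
  obtains H where "fixed_end_variation A a b g H" "\<And>t. t \<in> {a..b} \<Longrightarrow> dlog H (0, t) (1, 0) = \<eta> t"
proof -
  obtain r1 where r1: "r1 > 0" "smooth_on {a-r1<..<b+r1} \<eta>" and ends: "\<eta> a = 0" "\<eta> b = 0"
    using adm unfolding admissible_def by blast
  obtain r2 where r2: "r2 > 0" "{a-r2<..<b+r2} \<subseteq> J" by (rule J_collar)
  obtain d where d: "d > 0" "ball unit_coord d \<subseteq> chart_img unit_chart"
    by (rule openE[OF chart_img_open[OF unit_chart(1)] unit_chart(4)])
  have "continuous_on {a - r1/2..b + r1/2} \<eta>"
    by (rule continuous_on_subset[OF smooth_on_imp_continuous_on[OF r1(2)]]) (use r1(1) in auto)
  then have "bounded (\<eta> ` {a - r1/2..b + r1/2})"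
    by (intro compact_imp_bounded compact_continuous_image compact_Icc)
  then obtain K where K: "K > 0" "\<And>t. t \<in> {a - r1/2..b + r1/2} \<Longrightarrow> norm (\<eta> t) \<le> K"
    unfolding bounded_pos by auto
  \<comment> \<open>\<open>\<epsilon> \<eta>(t)\<close> has norm below \<open>d\<close> for \<open>\<bar>\<epsilon>\<bar> < d/K\<close>; half of \<open>r1\<close> keeps \<open>t\<close> where \<open>K\<close> bounds \<open>\<eta>\<close>.\<close>
  define r where "r = min (r1/2) (min r2 (d/K))"
  have rle: "r > 0" "r \<le> r1/2" "r \<le> r2" "r \<le> d/K"
    unfolding r_def using r1(1) r2(1) d(1) K(1) by (simp_all only: min_less_iff_conj min.cobounded1
        min.coboundedI2 min.cobounded2 half_gt_zero divide_pos_pos simp_thms)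
  then have r: "r > 0" "{a-r<..<b+r} \<subseteq> {a-r1<..<b+r1}" "{a-r<..<b+r} \<subseteq> {a-r2<..<b+r2}"
    using r1 by auto
  have rJ: "{a-r<..<b+r} \<subseteq> J" using r(3) r2(2) by (rule order_trans)
  let ?E = "{-r<..<r}" and ?I = "{a-r<..<b+r}"
  let ?R = "?E \<times> ?I"
  have R: "open ?R" by (intro open_Times) auto
  define H where "H = (\<lambda>z. mul (g (snd z)) (param unit_chart (unit_coord + fst z *\<^sub>R \<eta> (snd z))))"
  have img: "unit_coord + fst z *\<^sub>R \<eta> (snd z) \<in> chart_img unit_chart" if z: "z \<in> ?R" for z
  proof -
    have "norm (fst z *\<^sub>R \<eta> (snd z)) \<le> \<bar>fst z\<bar> * K"
      using K(2)[of "snd z"] z rle by (auto intro!: mult_left_mono)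
    also have "\<dots> < r * K" using z K by (auto intro!: mult_strict_right_mono)
    also have "\<dots> \<le> d / K * K" using K rle(4) by (intro mult_right_mono) auto
    also have "\<dots> = d" using K by simp
    finally show ?thesis using d(2) by (auto simp: dist_norm)
  qed
  have "smooth_on ?R (\<lambda>z. \<eta> (snd z))"
    by (rule smooth_on_compose[OF R open_greaterThanLessThan _ r1(2) smooth_on_bounded_linear[OF bounded_linear_snd]])
       (use r(2) in auto)
  then have "smooth_on ?R (\<lambda>z. unit_coord + fst z *\<^sub>R \<eta> (snd z))"
    by (intro smooth_on_add[OF R smooth_on_const] smooth_on_bounded_bilinear[OF R bounded_bilinear_scaleR]
        smooth_on_bounded_linear[OF bounded_linear_fst])
  then have "smooth_map_on A ?R (\<lambda>z. param unit_chart (unit_coord + fst z *\<^sub>R \<eta> (snd z)))"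
    by (rule smooth_map_on_compose[OF R chart_img_open[OF unit_chart(1)] smooth_map_on_param[OF unit_chart(1)]])
       (use img in auto)
  moreover have "smooth_map_on A ?R (\<lambda>z. g (snd z))"
    by (rule smooth_map_on_compose[OF R J(1) g_smooth smooth_on_bounded_linear[OF bounded_linear_snd]])
       (use rJ in auto)
  ultimately have H: "smooth_map_on A ?R H"
    unfolding H_def by (intro smooth_map_on_mul[OF R])
  have H0: "H (0, t) = g t" for t by (simp add: H_def unit_chart)
  have "fixed_end_variation A a b g H"
    unfolding fixed_end_variation_def using r(1) H H0 by (auto simp: H_def ends unit_chart)
  moreover have "dlog H (0, t) (1, 0) = \<eta> t" if t: "t \<in> {a..b}" for t
  proof (rule dlog_chart_curve[where j="\<lambda>\<epsilon>. (\<epsilon>, t)" and S=UNIV, OF R _ H])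
    show "(0, t) \<in> ?R" using t r by auto
    show "((\<lambda>\<epsilon>. (\<epsilon>, t)) has_derivative (\<lambda>k. k *\<^sub>R (1, 0))) (at 0)"
      by (auto intro!: derivative_eq_intros)
    show "H (s, t) = mul (H (0, t)) (param unit_chart (unit_coord + s *\<^sub>R \<eta> t))" for s
      unfolding H0 by (simp add: H_def)
  qed auto
  ultimately show ?thesis by (rule that)
qed

lemma lagrange_dalembert_iff_residual:
  "lagrange_dalembert_delay A L F \<tau> a b g \<longleftrightarrow> (\<forall>t\<in>{a..b}. residual t = 0)"
  unfolding residual_zero_iff_weak
proof
  assume LDA: "lagrange_dalembert_delay A L F \<tau> a b g"
  show "\<forall>\<eta>. admissible \<eta> \<longrightarrow> integral {a..b} (\<lambda>t. blinfun_apply (residual t) (\<eta> t)) = 0"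
  proof (intro allI impI)
    fix \<eta> assume "admissible \<eta>"
    then obtain H where H: "fixed_end_variation A a b g H" "\<And>t. t \<in> {a..b} \<Longrightarrow> dlog H (0, t) (1, 0) = \<eta> t"
      by (rule variation_exists) blast
    have "integral {a..b} (\<lambda>t. blinfun_apply (residual t) (\<eta> t))
        = integral {a..b} (\<lambda>t. blinfun_apply (residual t) (dlog H (0, t) (1, 0)))"
      by (rule integral_cong) (simp add: H(2))
    also have "\<dots> = 0"
      using LDA H(1) lagrange_dalembert_for_variation(1)[OF H(1)] unfolding lagrange_dalembert_delay_def by blast
    finally show "integral {a..b} (\<lambda>t. blinfun_apply (residual t) (\<eta> t)) = 0" .
  qed
next
  assume "\<forall>\<eta>. admissible \<eta> \<longrightarrow> integral {a..b} (\<lambda>t. blinfun_apply (residual t) (\<eta> t)) = 0"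
  then show "lagrange_dalembert_delay A L F \<tau> a b g"
    unfolding lagrange_dalembert_delay_def using lagrange_dalembert_for_variation by blast
qed

end
theorem theorem5p2:
  fixes A :: "('a::{t2_space,second_countable_topology}, 'e::euclidean_space) chart set"
    and mul :: "'a \<Rightarrow> 'a \<Rightarrow> 'a" and one :: 'a and ginv :: "'a \<Rightarrow> 'a"
    and L :: "'a \<times> 'e \<Rightarrow> real" and F :: "('a, 'e) force"
    and \<tau> a b :: real and J :: "real set" and g :: "real \<Rightarrow> 'a"
    and l :: "'e \<Rightarrow> real" and f :: "'e \<Rightarrow> 'e \<Rightarrow> ('e \<Rightarrow>\<^sub>L real)" and \<xi> :: "real \<Rightarrow> 'e"
  assumes G: "lie_group A mul one ginv"
    and L_smooth: "smooth_lagrangian A L" and L_inv: "left_invariant A mul L"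
    and F_smooth: "smooth_force A F" and F_equiv: "equivariant_force A mul F"
    and l_def: "l = lagrangian_at_one one L"
    and f_def: "f = force_at_one one F"
    and delay: "\<tau> \<ge> 0" and ab: "a < b"
    and J: "open J" "{a - \<tau>..b} \<subseteq> J"
    and g_smooth: "smooth_map_on A J g"
    and \<xi>_def: "\<xi> = body_velocity A mul ginv g"
  shows "(euler_lagrange_delay A L F \<tau> a b g \<longleftrightarrow> lagrange_dalembert_delay A L F \<tau> a b g)
       \<and> (lagrange_dalembert_delay A L F \<tau> a b g \<longleftrightarrow> euler_poincare_delay A mul one l f \<tau> a b \<xi>)
       \<and> (euler_poincare_delay A mul one l f \<tau> a b \<xi> \<longleftrightarrow> reduced_principle_delay A mul one l f \<tau> a b \<xi>)"
proof -
  interpret delayed_lie_group_system A mul one ginv L F \<tau> a b J g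
    by (intro delayed_lie_group_system.intro delayed_lie_group_system_axioms.intro
        G L_smooth L_inv F_smooth F_equiv delay ab J g_smooth)
  show ?thesis
    unfolding l_def f_def \<xi>_def
    by (simp only: euler_lagrange_iff_residual lagrange_dalembert_iff_residual
        euler_poincare_iff_residual reduced_principle_iff_residual simp_thms)
qed

end
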